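(* Let $k\ge 3$ and let $\Gamma$ be the suspension of a path of length $k$, with edges oriented and labeled as in the context, so that $H_{\Gamma}$ has the finite presentation $\langle\mathcal A,\mathcal B,\mathcal X\mid\mathcal R\rangle$ given in the context. Let $w$ be a freely reduced word in these generators that represents the identity of $H_{\Gamma}$. Let $T$ be a stack in a minimal van Kampen diagram $\Delta$ for $w$ such that the top of $T$ has length $l$ and the height of $T$ is $h$. Then the area of $T$ satisfies $$\mathrm{Area}(T)\leq K(lh^{2}+h^{3}),$$ where $K$ is a positive constant that does not depend on $l$ and $h$.
   Context: The group $H_{\Gamma}$ is the Bestvina--Brady group of $\Gamma$: the kernel of the homomorphism $A_\Gamma\to\mathbb Z$ sending every vertex generator to $1$, where $A_{\Gamma}=\langle V(\Gamma)\mid [u,v]=1 \text{ for adjacent } u,v\rangle$. The graph $\Gamma$ is the join of two non-adjacent vertices $p,q$ and a path with consecutive vertices $v_1,\dots,v_{k+1}$. Its oriented labeled edges are: $x_i$ from $v_i$ to $v_{i+1}$ ($1\le i\le k$), $a_i$ from $p$ to $v_i$ and $b_i$ from $q$ to $v_i$ ($1\le i\le k+1$). The Dicks--Leary presentation of $H_\Gamma$ is $\langle\mathcal A,\mathcal B,\mathcal X\mid\mathcal R\rangle$ with $\mathcal A=\{a_1,\dots,a_{k+1}\}$, $\mathcal B=\{b_1,\dots,b_{k+1}\}$, $\mathcal X=\{x_1,\dots,x_k\}$ and $\mathcal R=\{a_ix_i=a_{i+1}=x_ia_i,\ b_ix_i=b_{i+1}=x_ib_i : 1\le i\le k\}$,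 so all $2$-cells of van Kampen diagrams are triangles. Put $\alpha=\mathcal A$ and $\beta=\mathcal B$; every relator triangle has exactly two edges in one of $\alpha,\beta$ and none in the other. For $\tau\in\{\alpha,\beta\}$, a $\tau$-corridor in $\Delta$ is a corridor consisting of triangles, each with exactly two edges labeled in $\tau$, consecutive triangles meeting along an edge labeled in $\tau$. Each corridor $C$ has boundary word $u'v''u''v'$ (up to cyclic permutation), where $u',u''$ are letters of $\tau$ labeling edges on $\partial\Delta$ (the two ends of the corridor), and $v',v''$ (the two sides) are words in the free group $F(x_1,\dots,x_k)$. Let $C_i$, $1\le i\le h$, be corridors in $\Delta$ (each an $\alpha$- or a $\beta$-corridor) with boundary words $u_i'v_i''u_i''v_i'$. If $u_1',\dots,u_h'$ and $u_1'',\dots,u_h''$ are two sets of consecutive letters on $\partial\Delta$ and $v_i''=v_{i+1}'$ for $1\le i\le h-1$, then the subdiagram $T$ of $\Delta$ obtained by gluing $C_1,\dots,C_h$ along $v_1''=v_2',\dots,v_{h-1}''=v_h'$ is called a stack. The number $h$ is its height. The shorter of the words $v_1'$ and $v_h''$ is the top of $T$ and the longer is the bottom (if the lengths are equal, either one may be called the top and the other the bottom). $\mathrm{Area}(T)$ is the number of $2$-cells of $T$. A van Kampen diagram for $w$ is minimal if it has the least number of $2$-cells among all van Kampen diagrams for $w$. *)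

theory Defs
  imports Complex_Main "HOL-Library.Multiset" "HOL-Algebra.Elementary_Groups"
    "HOL-Combinatorics.Orbits"
begin

section \<open>Words and presented groups\<close>

text \<open>The letter \<open>(x, True)\<close> is the generator \<open>x\<close>, and \<open>(x, False)\<close> is its inverse.\<close>

type_synonym 'g letter = "'g \<times> bool"
type_synonym 'g word = "'g letter list"

definition inv_letter :: "'g letter \<Rightarrow> 'g letter" where
  "inv_letter x = (fst x, \<not> snd x)"

definition inv_word :: "'g word \<Rightarrow> 'g word" where
  "inv_word w = rev (map inv_letter w)"

definition words :: "'g set \<Rightarrow> 'g word set" where
  "words S = lists (S \<times> UNIV)"

definition freely_reduced :: "'g word \<Rightarrow> bool" where
  "freely_reduced w \<longleftrightarrow> successively (\<lambda>x y. y \<noteq> inv_letter x) w"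

inductive_set word_rel :: "'g set \<Rightarrow> 'g word set \<Rightarrow> ('g word \<times> 'g word) set"
  for S :: "'g set" and R :: "'g word set" where
  refl: "u \<in> words S \<Longrightarrow> (u, u) \<in> word_rel S R"
| sym: "(u, v) \<in> word_rel S R \<Longrightarrow> (v, u) \<in> word_rel S R"
| trans: "(u, v) \<in> word_rel S R \<Longrightarrow> (v, z) \<in> word_rel S R \<Longrightarrow> (u, z) \<in> word_rel S R"
| cancel: "u \<in> words S \<Longrightarrow> v \<in> words S \<Longrightarrow> x \<in> S \<times> UNIV \<Longrightarrow>
    (u @ [x, inv_letter x] @ v, u @ v) \<in> word_rel S R"
| relator: "u \<in> words S \<Longrightarrow> v \<in> words S \<Longrightarrow> r \<in> R \<Longrightarrow> r \<in> words S \<Longrightarrow>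
    (u @ r @ v, u @ v) \<in> word_rel S R"

definition presented_group :: "'g set \<Rightarrow> 'g word set \<Rightarrow> 'g word set monoid" where
  "presented_group S R =
    \<lparr> carrier = words S // word_rel S R,
      monoid.mult = (\<lambda>U W. \<Union>u\<in>U. \<Union>w\<in>W. word_rel S R `` {u @ w}),
      one = word_rel S R `` {[]} \<rparr>"

lemma word_rel_words: "(u, v) \<in> word_rel S R \<Longrightarrow> u \<in> words S \<and> v \<in> words S"
  by (induction rule: word_rel.induct) (auto simp: words_def inv_letter_def)

lemma equiv_word_rel: "equiv (words S) (word_rel S R)"
  by (rule equivI)
    (auto simp: refl_on_def sym_def trans_def dest: word_rel_words
      intro: word_rel.refl word_rel.sym word_rel.trans)

lemma word_rel_append_left:
  assumes "(u, v) \<in> word_rel S R" "z \<in> words S"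
  shows "(z @ u, z @ v) \<in> word_rel S R"
  using assms
proof (induction rule: word_rel.induct)
  case (cancel u v x)
  then show ?case using word_rel.cancel[of "z @ u" S v x R] by (auto simp: words_def)
next
  case (relator u v r)
  then show ?case using word_rel.relator[of "z @ u" S v r R] by (auto simp: words_def)
next
  case (refl u)
  then show ?case by (auto simp: words_def intro: word_rel.refl)
qed (blast intro: word_rel.sym word_rel.trans)+

lemma word_rel_append_right:
  assumes "(u, v) \<in> word_rel S R" "z \<in> words S"
  shows "(u @ z, v @ z) \<in> word_rel S R"
  using assms
proof (induction rule: word_rel.induct)
  case (cancel u v x)
  then show ?case using word_rel.cancel[of u S "v @ z" x R] by (auto simp: words_def)
next
  case (relator u v r)
  then show ?case using word_rel.relator[of u S "v @ z" r R] by (auto simp: words_def)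
next
  case (refl u)
  then show ?case by (auto simp: words_def intro: word_rel.refl)
qed (blast intro: word_rel.sym word_rel.trans)+

lemma presented_mult:
  assumes "u \<in> words S" "v \<in> words S"
  shows "word_rel S R `` {u} \<otimes>\<^bsub>presented_group S R\<^esub> word_rel S R `` {v} = word_rel S R `` {u @ v}"
proof -
  have "congruent2 (word_rel S R) (word_rel S R) (\<lambda>u w. word_rel S R `` {u @ w})"
  proof (rule congruent2I')
    fix u u' v v' assume "(u, u') \<in> word_rel S R" "(v, v') \<in> word_rel S R"
    then have "(u @ v, u' @ v') \<in> word_rel S R"
      by (meson word_rel.trans word_rel_append_left word_rel_append_right word_rel_words)
    then show "word_rel S R `` {u @ v} = word_rel S R `` {u' @ v'}"
      by (rule equiv_class_eq[OF equiv_word_rel])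
  qed
  from UN_equiv_class2[OF equiv_word_rel equiv_word_rel this assms]
  show ?thesis by (simp add: presented_group_def)
qed

lemma inv_word_words: "u \<in> words S \<Longrightarrow> inv_word u \<in> words S"
  by (induction u) (auto simp: inv_word_def words_def inv_letter_def)

lemma inv_word_rel: "u \<in> words S \<Longrightarrow> (inv_word u @ u, []) \<in> word_rel S R"
proof (induction u)
  case Nil
  then show ?case by (auto simp: inv_word_def words_def intro: word_rel.refl)
next
  case (Cons x u)
  then have x: "inv_letter x \<in> S \<times> UNIV" and u: "u \<in> words S"
    by (auto simp: words_def inv_letter_def)
  have "(inv_word u @ [inv_letter x, inv_letter (inv_letter x)] @ u, inv_word u @ u) \<in> word_rel S R"
    by (rule word_rel.cancel[OF inv_word_words[OF u] u x])
  moreover have "inv_word u @ [inv_letter x, inv_letter (inv_letter x)] @ u = inv_word (x # u) @ x # u"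
    by (simp add: inv_word_def inv_letter_def)
  ultimately have "(inv_word (x # u) @ x # u, inv_word u @ u) \<in> word_rel S R" by (simp only:)
  then show ?case by (rule word_rel.trans[OF _ Cons.IH[OF u]])
qed

lemma group_presented_group: "group (presented_group S R)" (is "group ?G")
proof (rule groupI)
  have car: "\<exists>u \<in> words S. U = word_rel S R `` {u}" if "U \<in> carrier ?G" for U
    using that by (auto simp: presented_group_def quotient_def)
  have cls: "word_rel S R `` {u} \<in> carrier ?G" if "u \<in> words S" for u
    using that by (auto simp: presented_group_def quotient_def)
  have app: "u @ v \<in> words S" if "u \<in> words S" "v \<in> words S" for u v :: "'a word"
    using that by (auto simp: words_def)
  have nil: "[] \<in> words S" by (simp add: words_def)
  have one: "\<one>\<^bsub>?G\<^esub> = word_rel S R `` {[]}" by (simp add: presented_group_def)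
  show "\<one>\<^bsub>?G\<^esub> \<in> carrier ?G" using one cls nil by simp
  fix x y z assume "x \<in> carrier ?G"
  then obtain u where u: "u \<in> words S" "x = word_rel S R `` {u}" using car by blast
  show "\<one>\<^bsub>?G\<^esub> \<otimes>\<^bsub>?G\<^esub> x = x" using u nil by (simp add: one presented_mult)
  have iu: "inv_word u \<in> words S" using u by (simp add: inv_word_words)
  have "word_rel S R `` {inv_word u} \<otimes>\<^bsub>?G\<^esub> x = \<one>\<^bsub>?G\<^esub>"
    using u iu equiv_class_eq[OF equiv_word_rel inv_word_rel] by (auto simp: one presented_mult)
  then show "\<exists>y\<in>carrier ?G. y \<otimes>\<^bsub>?G\<^esub> x = \<one>\<^bsub>?G\<^esub>" using cls iu by blast
  assume "y \<in> carrier ?G"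
  then obtain v where v: "v \<in> words S" "y = word_rel S R `` {v}" using car by blast
  show "x \<otimes>\<^bsub>?G\<^esub> y \<in> carrier ?G" using u v by (simp add: presented_mult cls app)
  assume "z \<in> carrier ?G"
  then obtain t where t: "t \<in> words S" "z = word_rel S R `` {t}" using car by blast
  show "x \<otimes>\<^bsub>?G\<^esub> y \<otimes>\<^bsub>?G\<^esub> z = x \<otimes>\<^bsub>?G\<^esub> (y \<otimes>\<^bsub>?G\<^esub> z)"
    using u v t by (simp add: presented_mult app)
qed


section \<open>Right-angled Artin groups and Bestvina-Brady groups\<close>

definition raag_rels :: "('v \<times> 'v) set \<Rightarrow> 'v word set" where
  "raag_rels E = {[(u, True), (v, True), (u, False), (v, False)] | u v. (u, v) \<in> E}"

definition raag :: "'v set \<Rightarrow> ('v \<times> 'v) set \<Rightarrow> 'v word set monoid" where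
  "raag V E = presented_group V (raag_rels E)"

definition raag_elem :: "'v set \<Rightarrow> ('v \<times> 'v) set \<Rightarrow> 'v word \<Rightarrow> 'v word set" where
  "raag_elem V E u = word_rel V (raag_rels E) `` {u}"

definition exponent_sum :: "'v word \<Rightarrow> int" where
  "exponent_sum w = (\<Sum>x\<leftarrow>w. if snd x then 1 else - 1)"

text \<open>All words in a class of \<open>raag V E\<close> have the same exponent sum, so \<open>raag_height\<close> is
  the homomorphism onto the integers that sends every vertex generator to 1.\<close>

definition raag_height :: "'v word set \<Rightarrow> int" where
  "raag_height U = the_elem (exponent_sum ` U)"

definition bestvina_brady :: "'v set \<Rightarrow> ('v \<times> 'v) set \<Rightarrow> 'v word set monoid" where
  "bestvina_brady V E = (raag V E)\<lparr>carrier := kernel (raag V E) integer_group raag_height\<rparr>"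

lemma raag_height_elem:
  assumes "u \<in> words V"
  shows "raag_height (raag_elem V E u) = exponent_sum u"
proof -
  have inv: "exponent_sum a = exponent_sum b" if "(a, b) \<in> word_rel V (raag_rels E)" for a b
    using that
  proof (induction rule: word_rel.induct)
    case (relator u v r)
    then show ?case by (auto simp: raag_rels_def exponent_sum_def)
  qed (simp_all add: exponent_sum_def inv_letter_def)
  have "exponent_sum ` raag_elem V E u = {exponent_sum u}"
  proof
    show "exponent_sum ` raag_elem V E u \<subseteq> {exponent_sum u}"
      using inv[of u] by (auto simp only: raag_elem_def Image_singleton_iff)
    show "{exponent_sum u} \<subseteq> exponent_sum ` raag_elem V E u"
      using word_rel.refl[OF assms] by (simp add: raag_elem_def)
  qed
  then show ?thesis by (simp add: raag_height_def)
qed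

lemma raag_height_hom: "raag_height \<in> hom (raag V E) integer_group"
proof (rule homI)
  have car: "\<exists>u \<in> words V. U = raag_elem V E u" if "U \<in> carrier (raag V E)" for U
    using that by (simp add: raag_def raag_elem_def presented_group_def quotient_def)
  fix x y assume "x \<in> carrier (raag V E)" "y \<in> carrier (raag V E)"
  then obtain u v where uv: "u \<in> words V" "x = raag_elem V E u" "v \<in> words V" "y = raag_elem V E v"
    using car by blast
  have "x \<otimes>\<^bsub>raag V E\<^esub> y = raag_elem V E (u @ v)"
    using uv(1,3) by (simp only: uv(2,4)) (simp add: raag_def raag_elem_def presented_mult)
  moreover have "u @ v \<in> words V" using uv by (auto simp: words_def)
  ultimately show "raag_height (x \<otimes>\<^bsub>raag V E\<^esub> y) = raag_height x \<otimes>\<^bsub>integer_group\<^esub> raag_height y"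
    by (simp only: uv(2,4) raag_height_elem uv(1,3)) (simp add: exponent_sum_def integer_group_def)
qed (simp add: integer_group_def)

lemma group_bestvina_brady: "group (bestvina_brady V E)"
proof -
  have "group (raag V E)" by (simp add: raag_def group_presented_group)
  then have "group_hom (raag V E) integer_group raag_height"
    using raag_height_hom by (auto simp: group_hom_def group_hom_axioms_def group_integer_group)
  then show ?thesis
    unfolding bestvina_brady_def
    using group.subgroup_imp_group[OF \<open>group (raag V E)\<close> group_hom.subgroup_kernel] by blast
qed


section \<open>The suspension of a path with its Dicks-Leary presentation\<close>

datatype vertex = P | Q | V nat

datatype gen = A nat | B nat | X nat

fun src :: "gen \<Rightarrow> vertex" where
  "src (A i) = P" | "src (B i) = Q" | "src (X i) = V i"

fun tgt :: "gen \<Rightarrow> vertex" where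
  "tgt (A i) = V i" | "tgt (B i) = V i" | "tgt (X i) = V (i + 1)"

definition alpha :: "nat \<Rightarrow> gen set" where "alpha k = A ` {1..k + 1}"
definition beta :: "nat \<Rightarrow> gen set" where "beta k = B ` {1..k + 1}"
definition xgens :: "nat \<Rightarrow> gen set" where "xgens k = X ` {1..k}"

definition gens :: "nat \<Rightarrow> gen set" where
  "gens k = alpha k \<union> beta k \<union> xgens k"

definition susp_verts :: "nat \<Rightarrow> vertex set" where
  "susp_verts k = {P, Q} \<union> V ` {1..k + 1}"

definition susp_adj :: "nat \<Rightarrow> (vertex \<times> vertex) set" where
  "susp_adj k = (let E = (\<lambda>e. (src e, tgt e)) ` gens k in E \<union> E\<inverse>)"

abbreviation H_susp :: "nat \<Rightarrow> vertex word set monoid" where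
  "H_susp k \<equiv> bestvina_brady (susp_verts k) (susp_adj k)"

text \<open>The edge generator \<open>e\<close> stands for the element \<open>src e \<cdot> (tgt e)\<inverse>\<close> of the kernel.\<close>

fun letter_val :: "gen letter \<Rightarrow> vertex word" where
  "letter_val (e, True) = [(src e, True), (tgt e, False)]"
| "letter_val (e, False) = [(tgt e, True), (src e, False)]"

definition gen_elem :: "nat \<Rightarrow> gen letter \<Rightarrow> vertex word set" where
  "gen_elem k x = raag_elem (susp_verts k) (susp_adj k) (letter_val x)"

lemma gen_elem_in_H:
  assumes "fst x \<in> gens k"
  shows "gen_elem k x \<in> carrier (H_susp k)"
proof -
  obtain e b where x: "x = (e, b)" by (cases x)
  have e: "src e \<in> susp_verts k" "tgt e \<in> susp_verts k"
    using assms by (auto simp: x gens_def alpha_def beta_def xgens_def susp_verts_def)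
  then have w: "letter_val x \<in> words (susp_verts k)"
    by (cases b) (simp_all add: x words_def)
  have "exponent_sum (letter_val x) = 0"
    by (cases b) (simp_all add: x exponent_sum_def)
  moreover have "gen_elem k x \<in> carrier (raag (susp_verts k) (susp_adj k))"
    using quotientI[OF w] by (simp add: gen_elem_def raag_def raag_elem_def presented_group_def)
  ultimately show ?thesis
    using raag_height_elem[OF w]
    by (simp add: gen_elem_def bestvina_brady_def kernel_def integer_group_def)
qed

definition eval_word :: "nat \<Rightarrow> gen word \<Rightarrow> vertex word set" where
  "eval_word k w = foldr (\<lambda>x g. gen_elem k x \<otimes>\<^bsub>H_susp k\<^esub> g) w \<one>\<^bsub>H_susp k\<^esub>"

text \<open>Each equation \<open>l = r\<close> of the presentation is the relator \<open>l r\<inverse>\<close>.\<close>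

definition relators :: "nat \<Rightarrow> gen word set" where
  "relators k = (\<Union>i\<in>{1..k}. \<Union>c\<in>{A, B}.
     {[(c i, True), (X i, True), (c (i + 1), False)],
      [(X i, True), (c i, True), (c (i + 1), False)]})"


section \<open>Van Kampen diagrams\<close>

text \<open>A van Kampen diagram is encoded as a combinatorial map on the sphere in which one face, the
  complement of the diagram, is distinguished. A dart is an oriented edge, \<open>opp\<close> reverses
  darts, and \<open>nxt d\<close> is the dart that follows \<open>d\<close> on the boundary of the face to the left of
  \<open>d\<close>. So faces are the orbits of \<open>nxt\<close>, and the darts with a common initial vertex form an
  orbit of \<open>nxt \<circ> opp\<close>. The list \<open>outer\<close> runs once around the distinguished face, from the base
  point; it need not be a simple path. If there are no darts, the diagram is a single vertex.\<close>

record 'g diagram =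
  darts :: "nat set"
  opp :: "nat \<Rightarrow> nat"
  nxt :: "nat \<Rightarrow> nat"
  lab :: "nat \<Rightarrow> 'g letter"
  outer :: "nat list"

definition face_path :: "'g diagram \<Rightarrow> nat \<Rightarrow> nat list" where
  "face_path D d = map (\<lambda>i. (nxt D ^^ i) d) [0..<card (orbit (nxt D) d)]"

definition start_vertex :: "'g diagram \<Rightarrow> nat \<Rightarrow> nat set" where
  "start_vertex D d = orbit (nxt D \<circ> opp D) d"

definition num_vertices :: "'g diagram \<Rightarrow> nat" where
  "num_vertices D = (if darts D = {} then 1 else card (start_vertex D ` darts D))"

definition num_edges :: "'g diagram \<Rightarrow> nat" where
  "num_edges D = card ((\<lambda>d. {d, opp D d}) ` darts D)"

definition inner_darts :: "'g diagram \<Rightarrow> nat set" where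
  "inner_darts D = darts D - set (outer D)"

abbreviation cell :: "'g diagram \<Rightarrow> nat \<Rightarrow> nat set" where
  "cell D d \<equiv> orbit (nxt D) d"

definition area :: "'g diagram \<Rightarrow> nat" where
  "area D = card (cell D ` inner_darts D)"

text \<open>The equation with \<open>num_vertices\<close> is Euler's formula for the sphere, with the
  distinguished face left out: for a connected map it says that the diagram is planar and
  contractible.\<close>

definition planar_complex :: "'g diagram \<Rightarrow> bool" where
  "planar_complex D \<longleftrightarrow>
     finite (darts D) \<and>
     (\<forall>d\<in>darts D. opp D d \<in> darts D \<and> opp D d \<noteq> d \<and> opp D (opp D d) = d) \<and>
     nxt D permutes darts D \<and>
     (\<forall>d\<in>darts D. \<forall>e\<in>darts D. (d, e) \<in> {(x, y). x \<in> darts D \<and> (y = opp D x \<or> y = nxt D x)}\<^sup>*) \<and>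
     (if darts D = {} then outer D = [] else \<exists>d\<in>darts D. outer D = face_path D d) \<and>
     int (num_vertices D) - int (num_edges D) + int (area D) = 1"

definition van_kampen_diagram :: "'g set \<Rightarrow> 'g word set \<Rightarrow> 'g word \<Rightarrow> 'g diagram \<Rightarrow> bool" where
  "van_kampen_diagram S R w D \<longleftrightarrow>
     planar_complex D \<and>
     (\<forall>d\<in>darts D. fst (lab D d) \<in> S \<and> lab D (opp D d) = inv_letter (lab D d)) \<and>
     (\<forall>d\<in>inner_darts D. \<exists>r\<in>R. \<exists>n. map (lab D) (face_path D d) \<in> {rotate n r, rotate n (inv_word r)}) \<and>
     map (lab D) (outer D) = w"

definition minimal_diagram :: "'g set \<Rightarrow> 'g word set \<Rightarrow> 'g word \<Rightarrow> 'g diagram \<Rightarrow> bool" where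
  "minimal_diagram S R w D \<longleftrightarrow>
     van_kampen_diagram S R w D \<and> (\<forall>D'. van_kampen_diagram S R w D' \<longrightarrow> area D \<le> area D')"


section \<open>Corridors and stacks\<close>

definition dart_in :: "'g diagram \<Rightarrow> 'g set \<Rightarrow> nat \<Rightarrow> bool" where
  "dart_in D \<tau> d \<longleftrightarrow> fst (lab D d) \<in> \<tau>"

text \<open>\<open>tau_triangle D \<tau> d\<close>: the face to the left of \<open>d\<close> is a triangle of a \<open>\<tau>\<close>-corridor, entered
  through \<open>d\<close>. It is left through its other \<open>\<tau>\<close>-edge \<open>exit_dart D \<tau> d\<close>.\<close>

definition tau_triangle :: "'g diagram \<Rightarrow> 'g set \<Rightarrow> nat \<Rightarrow> bool" where
  "tau_triangle D \<tau> d \<longleftrightarrow> d \<in> inner_darts D \<and> dart_in D \<tau> d \<and>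
     card (cell D d) = 3 \<and> card {e \<in> cell D d. dart_in D \<tau> e} = 2"

definition exit_dart :: "'g diagram \<Rightarrow> 'g set \<Rightarrow> nat \<Rightarrow> nat" where
  "exit_dart D \<tau> d = (if dart_in D \<tau> (nxt D d) then nxt D d else nxt D (nxt D d))"

text \<open>A corridor is given by \<open>\<tau>\<close> and the darts through which its triangles are entered, in
  order from the end \<open>u'\<close> to the end \<open>u''\<close>. The ends are recorded as darts of \<open>outer\<close>.\<close>

type_synonym 'g corr = "'g set \<times> nat list"

definition first_end :: "'g diagram \<Rightarrow> 'g corr \<Rightarrow> nat" where
  "first_end D C = opp D (hd (snd C))"

definition last_end :: "'g diagram \<Rightarrow> 'g corr \<Rightarrow> nat" where
  "last_end D C = opp D (exit_dart D (fst C) (last (snd C)))"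

definition corridor :: "'g diagram \<Rightarrow> 'g corr \<Rightarrow> bool" where
  "corridor D C \<longleftrightarrow> snd C \<noteq> [] \<and>
     (\<forall>d\<in>set (snd C). tau_triangle D (fst C) d) \<and>
     successively (\<lambda>d e. e = opp D (exit_dart D (fst C) d)) (snd C) \<and>
     first_end D C \<in> set (outer D) \<and> last_end D C \<in> set (outer D)"

definition corr_cells :: "'g diagram \<Rightarrow> 'g corr \<Rightarrow> nat set set" where
  "corr_cells D C = cell D ` set (snd C)"

text \<open>The two sides, as dart paths directed from \<open>u'\<close> to \<open>u''\<close>: \<open>left_side\<close> is \<open>v'\<close> and
  \<open>right_side\<close> is \<open>v''\<close>. (In the cyclic boundary word \<open>u' v'' u'' v'\<close> the path \<open>v'\<close> is traversed
  backwards.) The third edge of a triangle entered through \<open>d\<close> is \<open>nxt d\<close> and lies on the right, or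
  is \<open>nxt (nxt d)\<close> and lies on the left. A side may have no edges, and then it is a vertex of the
  diagram; hence a side comes with its initial vertex.\<close>

definition left_side :: "'g diagram \<Rightarrow> 'g corr \<Rightarrow> nat list" where
  "left_side D C = map (\<lambda>d. opp D (nxt D (nxt D d)))
     (filter (\<lambda>d. dart_in D (fst C) (nxt D d)) (snd C))"

definition right_side :: "'g diagram \<Rightarrow> 'g corr \<Rightarrow> nat list" where
  "right_side D C = map (nxt D) (filter (\<lambda>d. \<not> dart_in D (fst C) (nxt D d)) (snd C))"

definition left_path :: "'g diagram \<Rightarrow> 'g corr \<Rightarrow> nat set \<times> nat list" where
  "left_path D C = (start_vertex D (hd (snd C)), left_side D C)"

definition right_path :: "'g diagram \<Rightarrow> 'g corr \<Rightarrow> nat set \<times> nat list" where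
  "right_path D C = (start_vertex D (nxt D (hd (snd C))), right_side D C)"

text \<open>\<open>consecutive_on_boundary D us\<close>: the darts \<open>us\<close> form, in some order, a segment of the cyclic
  boundary path.\<close>

definition consecutive_on_boundary :: "'g diagram \<Rightarrow> nat list \<Rightarrow> bool" where
  "consecutive_on_boundary D us \<longleftrightarrow>
     (\<exists>n. mset us = mset (take (length us) (rotate n (outer D))))"

definition stack :: "nat \<Rightarrow> gen diagram \<Rightarrow> gen corr list \<Rightarrow> bool" where
  "stack k D T \<longleftrightarrow> T \<noteq> [] \<and>
     (\<forall>C\<in>set T. fst C \<in> {alpha k, beta k} \<and> corridor D C) \<and>
     (\<forall>i j. i < j \<and> j < length T \<longrightarrow> corr_cells D (T ! i) \<inter> corr_cells D (T ! j) = {}) \<and>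
     consecutive_on_boundary D (map (first_end D) T) \<and>
     consecutive_on_boundary D (map (last_end D) T) \<and>
     successively (\<lambda>C C'. right_path D C = left_path D C') T"

definition stack_top :: "gen diagram \<Rightarrow> gen corr list \<Rightarrow> nat list" where
  "stack_top D T =
     (let v = left_side D (hd T); v' = right_side D (last T)
      in if length v \<le> length v' then v else v')"

definition stack_height :: "gen corr list \<Rightarrow> nat" where
  "stack_height T = length T"

definition stack_area :: "gen diagram \<Rightarrow> gen corr list \<Rightarrow> nat" where
  "stack_area D T = card (\<Union>C\<in>set T. corr_cells D C)"

end

theory Submission
  imports Defs
begin

text \<open>The two sides of a corridor are conjugate up to bounded corrections: if \<open>F\<close> is free on the
  letters \<open>x\<^sub>i\<close>, then both the \<open>a\<^sub>i\<close> and the \<open>b\<^sub>i\<close> act on \<open>F\<close>, up to inner automorphisms by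
  \<open>x\<^sub>1 \<cdots> x\<^sub>i\<^sub>-\<^sub>1\<close>, by the automorphism \<open>\<theta>\<close> that conjugates \<open>x\<^sub>i\<close> by \<open>x\<^sub>1 \<cdots> x\<^sub>i\<^sub>-\<^sub>1\<close>. As \<open>\<theta>\<^sup>n\<close>
  conjugates \<open>x\<^sub>i\<close> by \<open>x\<^sub>1\<^sup>n \<cdots> x\<^sub>i\<^sub>-\<^sub>1\<^sup>n\<close>, it stretches letters only linearly in \<open>n\<close>. Hence, \<open>n\<close> corridors
  away from a side of length \<open>l\<close>, the side is a product of \<open>O(l + n)\<close> factors of length \<open>O(n)\<close>. This
  bounds the length of the side because sides are freely reduced words: otherwise two adjacent
  triangles of a corridor are mirror images, and the diagram is not minimal.

  To see the latter, the two triangles are cut out and the remaining edges are reglued. This may pinch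
  off spheres, so one passes to the component of the outer face. That it is still planar follows
  from the nonnegativity of the genus of the other components, and for that the vertices, edges and
  faces of a combinatorial map are counted as cycles of permutations, which change by one when
  a permutation is multiplied by a transposition.\<close>

section \<open>Counting the orbits of permutations of a finite set\<close>

definition perm_on :: "('a \<Rightarrow> 'a) \<Rightarrow> 'a set \<Rightarrow> bool" where
  "perm_on f S \<longleftrightarrow> finite S \<and> f ` S \<subseteq> S \<and> inj_on f S"

definition num_orbits :: "('a \<Rightarrow> 'a) \<Rightarrow> 'a set \<Rightarrow> nat" where
  "num_orbits f S = card (orbit f ` S)"

lemma perm_onI: "finite S \<Longrightarrow> (\<And>x. x \<in> S \<Longrightarrow> f x \<in> S) \<Longrightarrow> inj_on f S \<Longrightarrow> perm_on f S"
  by (auto simp: perm_on_def)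

lemma perm_on_finite: "perm_on f S \<Longrightarrow> finite S"
  by (simp add: perm_on_def)

lemma perm_on_in: "perm_on f S \<Longrightarrow> x \<in> S \<Longrightarrow> f x \<in> S"
  by (auto simp: perm_on_def)

lemma perm_on_inj: "perm_on f S \<Longrightarrow> x \<in> S \<Longrightarrow> y \<in> S \<Longrightarrow> f x = f y \<longleftrightarrow> x = y"
  by (auto simp: perm_on_def inj_on_def)

lemma perm_on_image: "perm_on f S \<Longrightarrow> f ` S = S"
  by (simp add: perm_on_def endo_inj_surj)

lemma perm_on_comp: "perm_on f S \<Longrightarrow> perm_on g S \<Longrightarrow> perm_on (f \<circ> g) S"
  unfolding perm_on_def using comp_inj_on[of g S f] inj_on_subset[of f S "g ` S"]
  by (simp add: image_subset_iff)

lemma perm_on_transpose: "finite S \<Longrightarrow> a \<in> S \<Longrightarrow> b \<in> S \<Longrightarrow> perm_on (transpose a b) S"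
  by (auto simp: perm_on_def transpose_def inj_on_def)

lemma perm_on_subset:
  assumes "perm_on f S" "S' \<subseteq> S" "\<And>x. x \<in> S' \<Longrightarrow> f x \<in> S'"
  shows "perm_on f S'"
  using assms by (auto simp: perm_on_def intro: finite_subset inj_on_subset)

lemma perm_on_diff:
  assumes f: "perm_on f S" and sub: "S' \<subseteq> S" and inv: "\<And>x. x \<in> S' \<Longrightarrow> f x \<in> S'"
  shows "perm_on f (S - S')"
proof (rule perm_on_subset[OF f])
  fix x assume x: "x \<in> S - S'"
  have "f ` S' = S'" by (rule perm_on_image[OF perm_on_subset[OF f sub inv]])
  then have "f x \<notin> S'" using x sub perm_on_inj[OF f] by (metis DiffD1 DiffD2 imageE subsetD)
  then show "f x \<in> S - S'" using x perm_on_in[OF f] by auto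
qed auto

lemma orbit_closed:
  assumes "\<And>x. x \<in> S \<Longrightarrow> f x \<in> S" "x \<in> S"
  shows "orbit f x \<subseteq> S"
proof
  fix y assume "y \<in> orbit f x" then show "y \<in> S" by induction (use assms in auto)
qed

lemma perm_on_orbit_subset: "perm_on f S \<Longrightarrow> x \<in> S \<Longrightarrow> orbit f x \<subseteq> S"
  by (rule orbit_closed) (auto dest: perm_on_in)

lemma self_in_perm_orbit:
  assumes "perm_on f S" "x \<in> S"
  shows "x \<in> orbit f x"
proof -
  have sub: "orbit f x \<subseteq> S" by (rule perm_on_orbit_subset[OF assms])
  have "perm_on f (orbit f x)"
    by (rule perm_on_subset[OF assms(1) sub]) (auto intro: orbit.intros)
  then have "f x \<in> f ` orbit f x" by (simp add: perm_on_image orbit.base)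
  then show ?thesis using assms sub by (auto simp: perm_on_def inj_on_def)
qed

lemma perm_orbit_eq:
  assumes "perm_on f S" "x \<in> S" "y \<in> orbit f x"
  shows "orbit f y = orbit f x"
  using orbit_trans[of _ f y x] orbit_trans[of _ f x y] assms
    orbit_swap[OF self_in_perm_orbit[OF assms(1,2)] assms(3)] by blast

lemma perm_orbit_eq_iff:
  assumes "perm_on f S" "x \<in> S" "y \<in> S"
  shows "orbit f x = orbit f y \<longleftrightarrow> y \<in> orbit f x"
  using assms perm_orbit_eq self_in_perm_orbit by metis

lemma orbit_agree:
  assumes "\<And>x. x \<in> S \<Longrightarrow> f x = g x" "\<And>x. x \<in> S \<Longrightarrow> f x \<in> S" "a \<in> S"
  shows "orbit f a = orbit g a"
proof (rule orbit_cong0[of a S])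
  show "f \<in> S \<rightarrow> S" using assms by auto
qed (use assms in auto)

lemma num_orbits_agree:
  assumes "\<And>x. x \<in> S \<Longrightarrow> f x = g x" "\<And>x. x \<in> S \<Longrightarrow> f x \<in> S"
  shows "num_orbits f S = num_orbits g S"
proof -
  have "orbit f ` S = orbit g ` S"
    by (rule image_cong[OF HOL.refl], rule orbit_agree[of S]) (use assms in auto)
  then show ?thesis by (simp add: num_orbits_def)
qed

lemma num_orbits_split:
  assumes f: "perm_on f S" and sub: "S' \<subseteq> S" and inv: "\<And>x. x \<in> S' \<Longrightarrow> f x \<in> S'"
  shows "num_orbits f S = num_orbits f S' + num_orbits f (S - S')"
proof -
  have f': "perm_on f S'" by (rule perm_on_subset[OF f sub inv])
  have "orbit f ` S = orbit f ` S' \<union> orbit f ` (S - S')" using sub by blast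
  moreover have "orbit f ` S' \<inter> orbit f ` (S - S') = {}"
    using perm_on_orbit_subset[OF f'] self_in_perm_orbit[OF f] by blast
  moreover have "finite (orbit f ` S')" "finite (orbit f ` (S - S'))"
    using f' f by (auto simp: perm_on_def)
  ultimately show ?thesis by (simp add: num_orbits_def card_Un_disjoint)
qed

lemma transpose_merges_orbits:
  assumes f: "perm_on f S" and ab: "a \<in> S" "b \<in> S" and sep: "b \<notin> orbit f a"
  defines "g \<equiv> f \<circ> transpose a b"
  shows "b \<in> orbit g a" "num_orbits g S + 1 = num_orbits f S"
proof -
  have g: "perm_on g S"
    unfolding g_def by (intro perm_on_comp f perm_on_transpose ab perm_on_finite[OF f])
  have ne: "orbit f a \<noteq> orbit f b" using perm_orbit_eq_iff[OF f ab] sep by simp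
  have sep': "a \<notin> orbit f b" using perm_orbit_eq_iff[OF f ab(2,1)] ne by simp
  have gb: "g b = f a" "g a = f b" by (auto simp: g_def)
  have ga: "g x = f x" if "x \<noteq> a" "x \<noteq> b" for x using that by (simp add: g_def transpose_def)
  have 1: "y \<in> orbit g a" if "y \<in> orbit f b" for y
    using that
  proof induction
    case base then show ?case using orbit.base[of g a] gb by simp
  next
    case (step y)
    then show ?case using orbit.base[of g a] orbit.step[of y g a] gb ga[of y] sep'
      by (cases "y = b"; cases "y = a") auto
  qed
  have 2: "y \<in> orbit g b" if "y \<in> orbit f a" for y
    using that
  proof induction
    case base then show ?case using orbit.base[of g b] gb by simp
  next
    case (step y)
    then show ?case using orbit.base[of g b] orbit.step[of y g b] gb ga[of y] sep
      by (cases "y = a"; cases "y = b") auto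
  qed
  show b: "b \<in> orbit g a" by (rule 1[OF self_in_perm_orbit[OF f ab(2)]])
  let ?U = "orbit f a \<union> orbit f b"
  have clU: "g x \<in> ?U" if "x \<in> ?U" for x
    using that ga[of x] gb orbit.base[of f a] orbit.base[of f b] orbit.step[of x f a] orbit.step[of x f b]
    by (cases "x = a"; cases "x = b") auto
  have aU: "a \<in> ?U" using self_in_perm_orbit[OF f ab(1)] by simp
  have ob: "orbit g b = orbit g a" by (rule perm_orbit_eq[OF g ab(1) b])
  have oa: "orbit g a = ?U" using orbit_closed[of ?U g a] clU aU 1 2 ob by blast
  have U: "orbit g x = ?U" if "x \<in> ?U" for x
    using perm_orbit_eq[OF g ab(1)] that oa by simp
  have nU: "orbit g x = orbit f x" if x: "x \<in> S - ?U" for x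
  proof (rule HOL.sym, rule orbit_agree[of "S - ?U"])
    have inv: "perm_on f (S - ?U)"
    proof (rule perm_on_diff[OF f])
      show "?U \<subseteq> S" using perm_on_orbit_subset[OF f] ab by simp
    qed (use orbit.step[of _ f a] orbit.step[of _ f b] in blast)
    show "f y \<in> S - ?U" if "y \<in> S - ?U" for y by (rule perm_on_in[OF inv that])
    show "f y = g y" if "y \<in> S - ?U" for y
      using ga[of y] that self_in_perm_orbit[OF f] ab by fastforce
  qed (use x in auto)
  have imf: "orbit f ` S = insert (orbit f a) (insert (orbit f b) (orbit f ` (S - ?U)))"
    (is "_ = ?I")
  proof
    show "orbit f ` S \<subseteq> ?I"
    proof
      fix c assume "c \<in> orbit f ` S"
      then obtain x where "x \<in> S" "c = orbit f x" by blast
      then show "c \<in> ?I"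
        using perm_orbit_eq[OF f ab(1), of x] perm_orbit_eq[OF f ab(2), of x] by blast
    qed
  qed (use ab in auto)
  have "S = (S \<inter> ?U) \<union> (S - ?U)" by auto
  then have "orbit g ` S = orbit g ` (S \<inter> ?U) \<union> orbit g ` (S - ?U)" by (metis image_Un)
  moreover have "orbit g ` (S \<inter> ?U) = {?U}" using U aU ab by auto
  moreover have "orbit g ` (S - ?U) = orbit f ` (S - ?U)" by (rule image_cong) (auto simp: nU)
  ultimately have img: "orbit g ` S = insert ?U (orbit f ` (S - ?U))" by simp
  have notin: "C \<notin> orbit f ` (S - ?U)" if "C \<subseteq> ?U" for C
    using that self_in_perm_orbit[OF f] by blast
  have fin: "finite (orbit f ` (S - ?U))" using f by (simp add: perm_on_def)
  show "num_orbits g S + 1 = num_orbits f S"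
    using notin[of ?U] notin[of "orbit f a"] notin[of "orbit f b"] ne fin
    by (simp add: num_orbits_def imf img)
qed

lemma transpose_splits_orbit:
  assumes f: "perm_on f S" and ab: "a \<in> S" "b \<in> S" "a \<noteq> b" and same: "b \<in> orbit f a"
  defines "g \<equiv> f \<circ> transpose a b"
  shows "num_orbits g S = num_orbits f S + 1"
proof -
  have "a \<in> orbit f b" using perm_orbit_eq_iff[OF f] ab same by metis
  then obtain m where m: "a = (f ^^ m) b" "0 < m" by (auto simp: orbit_altdef)
  define n where "n = (LEAST n. 0 < n \<and> a = (f ^^ n) b)"
  have n: "0 < n" "a = (f ^^ n) b"
    using LeastI[of "\<lambda>n. 0 < n \<and> a = (f ^^ n) b" m] m by (auto simp: n_def)
  have least: "\<not> (0 < i \<and> a = (f ^^ i) b)" if "i < n" for i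
    using not_less_Least[of i "\<lambda>n. 0 < n \<and> a = (f ^^ n) b"] that unfolding n_def by blast
  define U where "U = (\<lambda>i. (f ^^ i) b) ` {1..n}"
  have aU: "a \<in> U" using n unfolding U_def by (intro image_eqI[of _ _ n]) auto
  have bU: "b \<notin> U"
  proof
    assume "b \<in> U"
    then obtain i where i: "b = (f ^^ i) b" "1 \<le> i" "i \<le> n" by (auto simp: U_def)
    then have "i < n" using n(2) ab(3) by (cases "i = n") auto
    have "(f ^^ n) b = (f ^^ (n - i)) ((f ^^ i) b)"
      using i(3) by (metis comp_apply funpow_add le_add_diff_inverse2)
    then have "a = (f ^^ (n - i)) b" using n i by simp
    then show False using least[of "n - i"] \<open>i < n\<close> i(2) by auto
  qed
  have clU: "g x \<in> U" if xU: "x \<in> U" for x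
  proof -
    obtain i where i: "x = (f ^^ i) b" "1 \<le> i" "i \<le> n"
      using xU unfolding U_def by (elim imageE) auto
    show ?thesis
    proof (cases "i = n")
      case True
      then have "g x = (f ^^ 1) b" using i n by (simp add: g_def)
      then show ?thesis using n(1) unfolding U_def by (intro image_eqI[of _ _ 1]) auto
    next
      case False
      then have "x \<noteq> a" "x \<noteq> b" using least[of i] i bU xU by auto
      then have "g x = (f ^^ Suc i) b" using i by (simp add: g_def transpose_def)
      then show ?thesis using False i unfolding U_def by (intro image_eqI[of _ _ "Suc i"]) auto
    qed
  qed
  have "b \<notin> orbit g a" using orbit_closed[of U g a] clU aU bU by blast
  moreover have "perm_on g S"
    unfolding g_def by (intro perm_on_comp f perm_on_transpose ab perm_on_finite[OF f])
  moreover have "g \<circ> transpose a b = f" by (auto simp: g_def fun_eq_iff)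
  ultimately show ?thesis using transpose_merges_orbits(2)[of g S a b] ab by simp
qed

section \<open>Components and Euler characteristic of a combinatorial map\<close>

definition num_comps :: "('a \<times> 'a) set \<Rightarrow> 'a set \<Rightarrow> nat" where
  "num_comps r S = card ((\<lambda>x. r\<^sup>* `` {x}) ` S)"

lemma num_comps_mono:
  assumes "finite S" "r \<subseteq> s\<^sup>*"
  shows "num_comps s S \<le> num_comps r S"
proof -
  have sub: "r\<^sup>* \<subseteq> s\<^sup>*" using assms(2) by (metis rtrancl_mono rtrancl_idemp)
  have "s\<^sup>* `` {x} = s\<^sup>* `` (r\<^sup>* `` {x})" for x
    using sub rtrancl_trans[of _ _ s] by blast
  then have "(\<lambda>x. s\<^sup>* `` {x}) ` S = (\<lambda>C. s\<^sup>* `` C) ` (\<lambda>x. r\<^sup>* `` {x}) ` S" 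
    unfolding image_image by simp
  then show ?thesis unfolding num_comps_def using assms(1) by (metis card_image_le finite_imageI)
qed

lemma num_comps_add_edge:
  assumes fin: "finite S" and sr: "sym (r\<^sup>*)" and ss: "sym (s\<^sup>*)"
    and sub: "s \<subseteq> (r \<union> {(a, b), (b, a)})\<^sup>*"
  shows "num_comps r S \<le> num_comps s S + 1"
proof -
  let ?c = "\<lambda>x. r\<^sup>* `` {x}" and ?C = "\<lambda>x. s\<^sup>* `` {x}"
  have sub': "s\<^sup>* \<subseteq> (r \<union> {(a, b), (b, a)})\<^sup>*" using sub by (metis rtrancl_mono rtrancl_idemp)
  have far: "(x, y) \<in> r\<^sup>* \<or> (a, y) \<in> r\<^sup>* \<or> (b, y) \<in> r\<^sup>*"
    if "(x, y) \<in> (r \<union> {(a, b), (b, a)})\<^sup>*" for x y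
    using that
  proof (induction rule: rtrancl_induct)
    case (step y z)
    then show ?case using rtrancl_into_rtrancl[of _ y r z] by blast
  qed simp
  have eq: "?c x = ?c y" if "(x, y) \<in> r\<^sup>*" for x y
    using that sr rtrancl_trans[of _ _ r] unfolding sym_def by blast
  have key: "?c x = ?c y" if "(x, y) \<in> s\<^sup>*" "(a, x) \<notin> r\<^sup>*" "(a, y) \<notin> r\<^sup>*" for x y
  proof -
    have "(y, x) \<in> s\<^sup>*" using that ss by (auto simp: sym_def)
    then have "(x, y) \<in> r\<^sup>* \<or> (b, y) \<in> r\<^sup>*" "(y, x) \<in> r\<^sup>* \<or> (b, x) \<in> r\<^sup>*"
      using far[of x y] far[of y x] that sub' by blast+
    then show ?thesis using eq by metis
  qed
  have "card (?c ` S - {?c a}) \<le> card (?C ` S)"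
  proof (rule surj_card_le[of "?C ` S" _ "\<lambda>K. ?c (SOME x. x \<in> S \<and> ?C x = K \<and> (a, x) \<notin> r\<^sup>*)"])
    show "?c ` S - {?c a} \<subseteq> (\<lambda>K. ?c (SOME x. x \<in> S \<and> ?C x = K \<and> (a, x) \<notin> r\<^sup>*)) ` ?C ` S"
    proof
      fix c assume "c \<in> ?c ` S - {?c a}"
      then obtain x where x: "x \<in> S" "c = ?c x" "(a, x) \<notin> r\<^sup>*" using eq by blast
      define y where "y = (SOME y. y \<in> S \<and> ?C y = ?C x \<and> (a, y) \<notin> r\<^sup>*)"
      have y: "y \<in> S \<and> ?C y = ?C x \<and> (a, y) \<notin> r\<^sup>*"
        unfolding y_def by (rule someI[of _ x]) (use x in auto)
      then have "(x, y) \<in> s\<^sup>*" by blast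
      then have "c = ?c y" using key[of x y] x y by simp
      then show "c \<in> (\<lambda>K. ?c (SOME x. x \<in> S \<and> ?C x = K \<and> (a, x) \<notin> r\<^sup>*)) ` ?C ` S"
        unfolding y_def using x(1) by blast
    qed
  qed (use fin in auto)
  moreover have "card (?c ` S) \<le> card (?c ` S - {?c a}) + 1"
    using card_Diff_singleton_if[of "?c ` S" "?c a"] by (auto split: if_splits)
  ultimately show ?thesis unfolding num_comps_def by linarith
qed

definition map_rel :: "('a \<Rightarrow> 'a) \<Rightarrow> ('a \<Rightarrow> 'a) \<Rightarrow> 'a set \<Rightarrow> ('a \<times> 'a) set" where
  "map_rel \<phi> \<alpha> S = {(x, y). x \<in> S \<and> (y = \<alpha> x \<or> y = \<phi> x)}"

lemma map_rel_closed:
  assumes "(x, y) \<in> (map_rel \<phi> \<alpha> S)\<^sup>*" "x \<in> T" "\<And>z. z \<in> T \<Longrightarrow> \<phi> z \<in> T" "\<And>z. z \<in> T \<Longrightarrow> \<alpha> z \<in> T"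
  shows "y \<in> T"
  using assms(1,2) by (induction rule: rtrancl_induct) (use assms(3,4) in \<open>auto simp: map_rel_def\<close>)

lemma orbit_reachable:
  assumes "y \<in> orbit f x" "x \<in> S" "\<And>z. z \<in> S \<Longrightarrow> f z \<in> S \<and> (z, f z) \<in> r\<^sup>*"
  shows "(x, y) \<in> r\<^sup>*"
proof -
  have "y \<in> S \<and> (x, y) \<in> r\<^sup>*" using assms(1)
  proof induction
    case (step y)
    then show ?case using assms(3)[of y] rtrancl_trans[of x y r "f y"] by auto
  qed (use assms in auto)
  then show ?thesis by simp
qed

lemma map_rel_step:
  assumes "x \<in> S"
  shows "(x, \<alpha> x) \<in> (map_rel \<phi> \<alpha> S)\<^sup>*" "(x, \<phi> x) \<in> (map_rel \<phi> \<alpha> S)\<^sup>*"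
  using assms by (auto simp: map_rel_def)

lemma sym_map_rel:
  assumes "perm_on \<phi> S" "perm_on \<alpha> S"
  shows "sym ((map_rel \<phi> \<alpha> S)\<^sup>*)" (is "sym (?r\<^sup>*)")
proof (rule symI)
  have rev: "(f x, x) \<in> ?r\<^sup>*" if f: "perm_on f S" "\<And>z. z \<in> S \<Longrightarrow> (z, f z) \<in> ?r\<^sup>*" and x: "x \<in> S" for f x
  proof (rule orbit_reachable[of x f "f x" S])
    show "x \<in> orbit f (f x)"
      using perm_orbit_eq[OF f(1) x orbit.base] self_in_perm_orbit[OF f(1) x] by simp
  qed (use x in \<open>auto intro: perm_on_in[OF f(1)] f(2)\<close>)
  fix x y assume "(x, y) \<in> ?r\<^sup>*"
  then show "(y, x) \<in> ?r\<^sup>*"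
  proof (induction rule: rtrancl_induct)
    case (step y z)
    then have "(z, y) \<in> ?r\<^sup>*"
      using rev[OF assms(1) map_rel_step(2)] rev[OF assms(2) map_rel_step(1)]
      by (auto simp: map_rel_def)
    then show ?case using step.IH rtrancl_trans by metis
  qed simp
qed

lemma vertex_orbit_reachable:
  assumes "perm_on \<phi> S" "perm_on \<alpha> S" "y \<in> orbit (\<phi> \<circ> \<alpha>) x" "x \<in> S"
  shows "(x, y) \<in> (map_rel \<phi> \<alpha> S)\<^sup>*"
proof (rule orbit_reachable[OF assms(3,4)])
  fix z assume z: "z \<in> S"
  then have "\<alpha> z \<in> S" using perm_on_in[OF assms(2)] by simp
  then show "(\<phi> \<circ> \<alpha>) z \<in> S \<and> (z, (\<phi> \<circ> \<alpha>) z) \<in> (map_rel \<phi> \<alpha> S)\<^sup>*"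
    using rtrancl_trans[OF map_rel_step(1)[OF z] map_rel_step(2)] perm_on_in[OF assms(1)] by simp
qed

text \<open>The induction removes the edges one by one; each removal changes the number of vertices by
  one, and it is compensated by the number of components.\<close>

lemma genus_nonneg:
  assumes "perm_on \<phi> S" "perm_on \<alpha> S" "\<And>x. x \<in> S \<Longrightarrow> \<alpha> (\<alpha> x) = x"
  shows "2 * (num_orbits (\<phi> \<circ> \<alpha>) S + num_orbits \<phi> S)
    \<le> 4 * num_comps (map_rel \<phi> \<alpha> S) S + card {x \<in> S. \<alpha> x \<noteq> x}"
  using assms(2,3)
proof (induction "card {x \<in> S. \<alpha> x \<noteq> x}" arbitrary: \<alpha> rule: less_induct)
  case less
  note \<phi> = assms(1)
  note fin = perm_on_finite[OF \<phi>]
  show ?case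
  proof (cases "\<exists>x\<in>S. \<alpha> x \<noteq> x")
    case False
    then have id: "\<alpha> x = x" if "x \<in> S" for x using that by auto
    have "num_orbits (\<phi> \<circ> \<alpha>) S = num_orbits \<phi> S"
      by (rule num_orbits_agree) (auto simp: id perm_on_in[OF \<phi>])
    moreover have "num_comps (map_rel \<phi> \<alpha> S) S = num_orbits \<phi> S"
    proof -
      have "(map_rel \<phi> \<alpha> S)\<^sup>* `` {x} = orbit \<phi> x" if x: "x \<in> S" for x
      proof (intro equalityI subsetI)
        fix y assume "y \<in> (map_rel \<phi> \<alpha> S)\<^sup>* `` {x}"
        then have "(x, y) \<in> (map_rel \<phi> \<alpha> S)\<^sup>*" by simp
        then show "y \<in> orbit \<phi> x"
        proof (rule map_rel_closed)
          fix z assume "z \<in> orbit \<phi> x"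
          then show "\<phi> z \<in> orbit \<phi> x" "\<alpha> z \<in> orbit \<phi> x"
            using id perm_on_orbit_subset[OF \<phi> x] by (auto intro: orbit.step)
        qed (rule self_in_perm_orbit[OF \<phi> x])
      next
        fix y assume y: "y \<in> orbit \<phi> x"
        have "(x, y) \<in> (map_rel \<phi> \<alpha> S)\<^sup>*"
          by (rule orbit_reachable[OF y x]) (simp add: perm_on_in[OF \<phi>] map_rel_step)
        then show "y \<in> (map_rel \<phi> \<alpha> S)\<^sup>* `` {x}" by simp
      qed
      then show ?thesis by (simp add: num_comps_def num_orbits_def)
    qed
    ultimately show ?thesis by simp
  next
    case True
    then obtain x where x: "x \<in> S" "\<alpha> x \<noteq> x" by blast
    define y where "y = \<alpha> x"
    have y: "y \<in> S" "x \<noteq> y" "\<alpha> y = x" using x perm_on_in[OF less.prems(1)] less.prems(2) by (auto simp: y_def)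
    define \<alpha>' where "\<alpha>' = \<alpha> \<circ> transpose x y"
    have \<alpha>': "perm_on \<alpha>' S"
      unfolding \<alpha>'_def by (intro perm_on_comp less.prems perm_on_transpose x y fin)
    have val: "\<alpha>' x = x" "\<alpha>' y = y" using x y by (auto simp: \<alpha>'_def y_def)
    have val': "\<alpha>' z = \<alpha> z" if "z \<noteq> x" "z \<noteq> y" for z using that by (simp add: \<alpha>'_def transpose_def)
    have inv': "\<alpha>' (\<alpha>' z) = z" if z: "z \<in> S" for z
    proof (cases "z = x \<or> z = y")
      case False
      then have "\<alpha> z \<noteq> x" "\<alpha> z \<noteq> y" using less.prems(2)[OF z] y by (auto simp: y_def)
      then show ?thesis using False less.prems(2)[OF z] by (simp add: val')
    qed (auto simp: val)
    let ?m = "{x \<in> S. \<alpha> x \<noteq> x}"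
    have "{z \<in> S. \<alpha>' z \<noteq> z} = ?m - {x, y}" using val val' by auto metis
    moreover have "{x, y} \<subseteq> ?m" using x y by (auto simp: y_def)
    moreover have "card {x, y} = 2" using y by simp
    ultimately have cm: "card {z \<in> S. \<alpha>' z \<noteq> z} + 2 = card ?m"
      using card_mono[of ?m "{x, y}"] fin by (simp add: card_Diff_subset)
    let ?r = "map_rel \<phi> \<alpha> S" and ?r' = "map_rel \<phi> \<alpha>' S"
    have IH: "2 * (num_orbits (\<phi> \<circ> \<alpha>') S + num_orbits \<phi> S) + 2 \<le> 4 * num_comps ?r' S + card ?m"
      using less.hyps[OF _ \<alpha>' inv'] cm by simp
    have \<sigma>: "\<phi> \<circ> \<alpha> = (\<phi> \<circ> \<alpha>') \<circ> transpose x y" by (simp add: \<alpha>'_def fun_eq_iff)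
    have \<sigma>': "perm_on (\<phi> \<circ> \<alpha>') S" by (rule perm_on_comp[OF \<phi> \<alpha>'])
    have "(z, \<alpha> z) \<in> ?r' \<union> {(x, y), (y, x)}" if "z \<in> S" for z
      using that val'[of z] y(3) y_def by (cases "z = x"; cases "z = y") (auto simp: map_rel_def)
    then have rr: "?r \<subseteq> ?r' \<union> {(x, y), (y, x)}" by (auto simp: map_rel_def)
    show ?thesis
    proof (cases "y \<in> orbit (\<phi> \<circ> \<alpha>') x")
      case True
      have "(x, y) \<in> ?r'\<^sup>*" by (rule vertex_orbit_reachable[OF \<phi> \<alpha>' True x(1)])
      moreover from this have "(y, x) \<in> ?r'\<^sup>*" using sym_map_rel[OF \<phi> \<alpha>'] by (simp add: sym_def)
      ultimately have "?r \<subseteq> ?r'\<^sup>*" using rr by auto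
      then have "num_comps ?r' S \<le> num_comps ?r S" by (rule num_comps_mono[OF fin])
      then show ?thesis using IH transpose_splits_orbit[OF \<sigma>' x(1) y(1,2) True] by (simp add: \<sigma>)
    next
      case False
      have "num_comps ?r' S \<le> num_comps ?r S + 1"
        by (rule num_comps_add_edge[OF fin]) (use rr sym_map_rel \<phi> \<alpha>' less.prems(1) in auto)
      then show ?thesis
        using IH transpose_merges_orbits(2)[OF \<sigma>' x(1) y(1) False] by (simp add: \<sigma>)
    qed
  qed
qed

definition fpf_involution :: "('a \<Rightarrow> 'a) \<Rightarrow> 'a set \<Rightarrow> bool" where
  "fpf_involution \<alpha> S \<longleftrightarrow> finite S \<and> (\<forall>x\<in>S. \<alpha> x \<in> S \<and> \<alpha> x \<noteq> x \<and> \<alpha> (\<alpha> x) = x)"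

lemma fpf_involutionD:
  assumes "fpf_involution \<alpha> S" "x \<in> S"
  shows "\<alpha> x \<in> S" "\<alpha> x \<noteq> x" "\<alpha> (\<alpha> x) = x"
  using assms by (auto simp: fpf_involution_def)

lemma fpf_involution_perm: "fpf_involution \<alpha> S \<Longrightarrow> perm_on \<alpha> S"
  unfolding fpf_involution_def by (rule perm_onI) (auto intro: inj_on_inverseI[of S \<alpha> \<alpha>])

definition genus_zero :: "('a \<Rightarrow> 'a) \<Rightarrow> ('a \<Rightarrow> 'a) \<Rightarrow> 'a set \<Rightarrow> bool" where
  "genus_zero \<phi> \<alpha> S \<longleftrightarrow>
    4 * num_comps (map_rel \<phi> \<alpha> S) S + card S = 2 * (num_orbits (\<phi> \<circ> \<alpha>) S + num_orbits \<phi> S)"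

lemma genus_nonneg_fpf:
  assumes "perm_on \<phi> S" "fpf_involution \<alpha> S"
  shows "2 * (num_orbits (\<phi> \<circ> \<alpha>) S + num_orbits \<phi> S) \<le> 4 * num_comps (map_rel \<phi> \<alpha> S) S + card S"
proof -
  have "{x \<in> S. \<alpha> x \<noteq> x} = S" using assms(2) by (auto simp: fpf_involution_def)
  then show ?thesis
    using genus_nonneg[OF assms(1) fpf_involution_perm[OF assms(2)]] fpf_involutionD[OF assms(2)] by simp
qed

text \<open>The edges \<open>f\<close> and \<open>g\<close> are cut open and reglued, \<open>f\<close> to \<open>g\<close> and \<open>\<alpha> f\<close> to \<open>\<alpha> g\<close>.\<close>

definition reglue :: "('a \<Rightarrow> 'a) \<Rightarrow> 'a \<Rightarrow> 'a \<Rightarrow> 'a \<Rightarrow> 'a" where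
  "reglue \<alpha> f g = transpose g (\<alpha> f) \<circ> \<alpha> \<circ> transpose g (\<alpha> f)"

lemma fpf_involution_reglue:
  assumes \<alpha>: "fpf_involution \<alpha> S" and fg: "f \<in> S" "g \<in> S"
  shows "fpf_involution (reglue \<alpha> f g) S"
proof -
  have fin: "finite S" using \<alpha> by (simp add: fpf_involution_def)
  have t: "perm_on (transpose g (\<alpha> f)) S"
    by (rule perm_on_transpose[OF fin fg(2) fpf_involutionD(1)[OF \<alpha> fg(1)]])
  have "reglue \<alpha> f g x \<in> S \<and> reglue \<alpha> f g x \<noteq> x \<and> reglue \<alpha> f g (reglue \<alpha> f g x) = x" if x: "x \<in> S" for x
  proof -
    let ?t = "transpose g (\<alpha> f)"
    have tx: "?t x \<in> S" by (rule perm_on_in[OF t x])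
    have "?t (\<alpha> (?t x)) \<noteq> ?t (?t x)"
      using fpf_involutionD(2)[OF \<alpha> tx] by (metis transpose_involutory)
    then show ?thesis using fpf_involutionD[OF \<alpha> tx] perm_on_in[OF t] by (simp add: reglue_def)
  qed
  then show ?thesis using fin by (auto simp: fpf_involution_def)
qed

lemma reglue_values:
  assumes "fpf_involution \<alpha> S" "f \<in> S" "g \<in> S" "f \<noteq> g"
  shows "reglue \<alpha> f g f = g"
    "\<And>e. e \<in> S \<Longrightarrow> e \<notin> {f, g, \<alpha> f, \<alpha> g} \<Longrightarrow> reglue \<alpha> f g e = \<alpha> e"
proof -
  show "reglue \<alpha> f g f = g"
    using fpf_involutionD[OF assms(1,2)] assms(4) by (simp add: reglue_def transpose_def)
  fix e assume e: "e \<in> S" "e \<notin> {f, g, \<alpha> f, \<alpha> g}"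
  then have "\<alpha> e \<noteq> g" "\<alpha> e \<noteq> \<alpha> f" using fpf_involutionD(3)[OF assms(1)] assms(2) by auto metis
  then show "reglue \<alpha> f g e = \<alpha> e" using e by (simp add: reglue_def transpose_def)
qed

text \<open>As \<open>f\<close> and \<open>\<alpha> g\<close> start at the same vertex, the first transposition below splits that vertex.
  The second one identifies the other ends of the two edges; if they already agree, it splits them,
  and this may disconnect the map.\<close>

lemma genus_zero_reglue:
  assumes \<phi>: "perm_on \<phi> S" and \<alpha>: "fpf_involution \<alpha> S" and fg: "f \<in> S" "g \<in> S" "f \<noteq> g"
    and corner: "f \<in> orbit (\<phi> \<circ> \<alpha>) (\<alpha> g)" and planar: "genus_zero \<phi> \<alpha> S"
  shows "genus_zero \<phi> (reglue \<alpha> f g) S"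
proof (cases "g = \<alpha> f")
  case True
  then have "reglue \<alpha> f g = \<alpha>" by (simp add: reglue_def)
  then show ?thesis using planar by simp
next
  case False
  note fin = perm_on_finite[OF \<phi>]
  let ?\<alpha>' = "reglue \<alpha> f g"
  have fpf': "fpf_involution ?\<alpha>' S" by (rule fpf_involution_reglue[OF \<alpha> fg(1,2)])
  note \<alpha>p = fpf_involution_perm[OF \<alpha>] and \<alpha>p' = fpf_involution_perm[OF fpf']
  define x y where "x = \<alpha> f" and "y = \<alpha> g"
  have xy: "x \<in> S" "y \<in> S" "\<alpha> x = f" "\<alpha> y = g" "\<alpha> f = x" "\<alpha> g = y"
    using fpf_involutionD[OF \<alpha>] fg by (auto simp: x_def y_def)
  have "x \<noteq> f" "y \<noteq> g" "g \<noteq> x" using fpf_involutionD(2)[OF \<alpha>] fg False by (auto simp: x_def y_def)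
  moreover from this have "x \<noteq> y" "y \<noteq> f" using xy fg by metis+
  ultimately have dist: "distinct [f, g, x, y]" using fg by auto
  have val: "?\<alpha>' f = g" "?\<alpha>' g = f" "?\<alpha>' x = y" "?\<alpha>' y = x"
    using dist xy by (auto simp: reglue_def transpose_def)
  have other: "?\<alpha>' z = \<alpha> z" if "z \<in> S" "z \<notin> {f, g, x, y}" for z
    using reglue_values(2)[OF \<alpha> fg that(1)] that by (simp add: x_def y_def)
  let ?\<sigma>1 = "(\<phi> \<circ> \<alpha>) \<circ> transpose y f"
  have \<sigma>: "perm_on (\<phi> \<circ> \<alpha>) S" by (rule perm_on_comp[OF \<phi> \<alpha>p])
  have \<sigma>1: "perm_on ?\<sigma>1 S" by (intro perm_on_comp \<sigma> perm_on_transpose fin fg xy)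
  have n1: "num_orbits ?\<sigma>1 S = num_orbits (\<phi> \<circ> \<alpha>) S + 1"
    using transpose_splits_orbit[OF \<sigma> xy(2) fg(1)] corner dist unfolding y_def by auto
  have agree: "(\<phi> \<circ> ?\<alpha>') z = (?\<sigma>1 \<circ> transpose x g) z" if "z \<in> S" for z
  proof (cases "z \<in> {f, g, x, y}")
    case True
    then show ?thesis using dist val xy by (auto simp: transpose_def)
  next
    case False
    then show ?thesis using other[OF that False] by (simp add: transpose_def)
  qed
  have \<sigma>': "perm_on (\<phi> \<circ> ?\<alpha>') S" by (rule perm_on_comp[OF \<phi> \<alpha>p'])
  have n2: "num_orbits (\<phi> \<circ> ?\<alpha>') S = num_orbits (?\<sigma>1 \<circ> transpose x g) S"
    by (rule num_orbits_agree[OF agree perm_on_in[OF \<sigma>']])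
  let ?r = "map_rel \<phi> \<alpha> S" and ?r' = "map_rel \<phi> ?\<alpha>' S"
  have step: "(z, ?\<alpha>' z) \<in> ?r'" "(z, \<phi> z) \<in> ?r'" if "z \<in> S" for z
    using that by (auto simp: map_rel_def)
  have sub: "?r \<subseteq> s\<^sup>*" if s: "?r' \<subseteq> s\<^sup>*" "(x, g) \<in> s\<^sup>*" "(g, x) \<in> s\<^sup>*" for s
  proof -
    have st: "(f, g) \<in> s\<^sup>*" "(g, f) \<in> s\<^sup>*" "(x, y) \<in> s\<^sup>*" "(y, x) \<in> s\<^sup>*"
      using s(1) step val fg xy by (metis subsetD)+
    then have st2: "(f, x) \<in> s\<^sup>*" "(x, f) \<in> s\<^sup>*" "(g, y) \<in> s\<^sup>*" "(y, g) \<in> s\<^sup>*"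
      using s(2,3) rtrancl_trans[of _ _ s] by blast+
    have oth: "(z, \<alpha> z) \<in> s\<^sup>*" if "z \<in> S" "z \<notin> {f, g, x, y}" for z
      using other[OF that] step(1)[OF that(1)] s(1) by auto
    have "(z, \<alpha> z) \<in> s\<^sup>*" if "z \<in> S" for z
    proof (cases "z \<in> {f, g, x, y}")
      case True
      then consider "z = f" | "z = g" | "z = x" | "z = y" by blast
      then show ?thesis using st2 xy by cases simp_all
    qed (rule oth[OF that])
    moreover have "(z, \<phi> z) \<in> s\<^sup>*" if "z \<in> S" for z using step(2)[OF that] s(1) by auto
    ultimately show ?thesis by (auto simp: map_rel_def)
  qed
  have le: "4 * num_comps ?r' S + card S \<le> 2 * (num_orbits (\<phi> \<circ> ?\<alpha>') S + num_orbits \<phi> S)"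
  proof (cases "g \<in> orbit ?\<sigma>1 x")
    case True
    have "?r \<subseteq> (?r' \<union> {(x, g), (g, x)})\<^sup>*" by (rule sub) auto
    then have "num_comps ?r' S \<le> num_comps ?r S + 1"
      by (rule num_comps_add_edge[OF fin sym_map_rel[OF \<phi> \<alpha>p'] sym_map_rel[OF \<phi> \<alpha>p]])
    moreover have "num_orbits (?\<sigma>1 \<circ> transpose x g) S = num_orbits ?\<sigma>1 S + 1"
      using transpose_splits_orbit[OF \<sigma>1 xy(1) fg(2)] True dist by auto
    ultimately show ?thesis using planar n1 n2 by (simp add: genus_zero_def)
  next
    case False
    have "g \<in> orbit (?\<sigma>1 \<circ> transpose x g) x"
      by (rule transpose_merges_orbits(1)[OF \<sigma>1 xy(1) fg(2) False])
    moreover have "orbit (\<phi> \<circ> ?\<alpha>') x = orbit (?\<sigma>1 \<circ> transpose x g) x"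
      by (rule orbit_agree[OF agree perm_on_in[OF \<sigma>'] xy(1)])
    ultimately have "(x, g) \<in> ?r'\<^sup>*" using vertex_orbit_reachable[OF \<phi> \<alpha>p' _ xy(1)] by simp
    moreover from this have "(g, x) \<in> ?r'\<^sup>*" using sym_map_rel[OF \<phi> \<alpha>p'] by (simp add: sym_def)
    ultimately have "?r \<subseteq> ?r'\<^sup>*" by (intro sub) auto
    then have "num_comps ?r' S \<le> num_comps ?r S" by (rule num_comps_mono[OF fin])
    moreover have "num_orbits (?\<sigma>1 \<circ> transpose x g) S + 1 = num_orbits ?\<sigma>1 S"
      by (rule transpose_merges_orbits(2)[OF \<sigma>1 xy(1) fg(2) False])
    ultimately show ?thesis using planar n1 n2 by (simp add: genus_zero_def)
  qed
  show ?thesis using le genus_nonneg_fpf[OF \<phi> fpf'] by (simp add: genus_zero_def)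
qed

lemma genus_zero_component:
  assumes \<phi>: "perm_on \<phi> S" and \<alpha>: "fpf_involution \<alpha> S" and planar: "genus_zero \<phi> \<alpha> S" and o: "o' \<in> S"
  defines "K \<equiv> (map_rel \<phi> \<alpha> S)\<^sup>* `` {o'}"
  shows "K \<subseteq> S" "\<And>x. x \<in> K \<Longrightarrow> \<phi> x \<in> K" "\<And>x. x \<in> K \<Longrightarrow> \<alpha> x \<in> K"
    "\<And>x y. x \<in> K \<Longrightarrow> y \<in> K \<Longrightarrow> (x, y) \<in> (map_rel \<phi> \<alpha> K)\<^sup>*"
    "4 + card K = 2 * (num_orbits (\<phi> \<circ> \<alpha>) K + num_orbits \<phi> K)"
proof -
  let ?r = "map_rel \<phi> \<alpha> S"
  note \<alpha>p = fpf_involution_perm[OF \<alpha>]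
  note symr = sym_map_rel[OF \<phi> \<alpha>p]
  show KS: "K \<subseteq> S" unfolding K_def using map_rel_closed[OF _ o perm_on_in[OF \<phi>] perm_on_in[OF \<alpha>p]] by auto
  show K\<phi>: "\<phi> x \<in> K" if "x \<in> K" for x
    using that KS rtrancl_trans[OF _ map_rel_step(2)[of x S \<phi> \<alpha>], of o'] by (auto simp: K_def)
  show K\<alpha>: "\<alpha> x \<in> K" if "x \<in> K" for x
    using that KS rtrancl_trans[OF _ map_rel_step(1)[of x S \<alpha> \<phi>], of o'] by (auto simp: K_def)
  have oK: "o' \<in> K" by (simp add: K_def)
  have inK: "(x, y) \<in> (map_rel \<phi> \<alpha> K)\<^sup>*" if "(x, y) \<in> ?r\<^sup>*" "x \<in> K" for x y
    using that
  proof (induction rule: rtrancl_induct)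
    case (step y z)
    then have "y \<in> K" using map_rel_closed[OF step.hyps(1) step.prems K\<phi> K\<alpha>] by simp
    then have "(y, z) \<in> map_rel \<phi> \<alpha> K" using step.hyps(2) by (auto simp: map_rel_def)
    then show ?case using step by (meson rtrancl.rtrancl_into_rtrancl)
  qed simp
  show conn: "(x, y) \<in> (map_rel \<phi> \<alpha> K)\<^sup>*" if "x \<in> K" "y \<in> K" for x y
  proof (rule inK[OF _ that(1)])
    have "(o', x) \<in> ?r\<^sup>*" "(o', y) \<in> ?r\<^sup>*" using that by (auto simp: K_def)
    then show "(x, y) \<in> ?r\<^sup>*" using symr rtrancl_trans[of x o' ?r y] by (auto simp: sym_def)
  qed
  let ?L = "S - K"
  have \<phi>K: "perm_on \<phi> K" and \<alpha>K: "fpf_involution \<alpha> K"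
    using perm_on_subset[OF \<phi> KS K\<phi>] KS K\<alpha> \<alpha> by (auto simp: fpf_involution_def intro: finite_subset)
  have \<phi>L: "perm_on \<phi> ?L" by (rule perm_on_diff[OF \<phi> KS K\<phi>])
  have "perm_on \<alpha> ?L" by (rule perm_on_diff[OF \<alpha>p KS K\<alpha>])
  then have \<alpha>L: "fpf_involution \<alpha> ?L"
    using \<alpha> perm_on_in[of \<alpha> ?L] by (auto simp: fpf_involution_def)
  have nK: "num_comps (map_rel \<phi> \<alpha> K) K = 1"
  proof -
    have "(map_rel \<phi> \<alpha> K)\<^sup>* `` {x} = K" if "x \<in> K" for x
      using conn[OF that] map_rel_closed[OF _ that K\<phi> K\<alpha>] by auto
    then have "(\<lambda>x. (map_rel \<phi> \<alpha> K)\<^sup>* `` {x}) ` K = {K}" using oK by auto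
    then show ?thesis by (simp add: num_comps_def)
  qed
  have nS: "num_comps (map_rel \<phi> \<alpha> ?L) ?L + 1 \<le> num_comps ?r S"
  proof -
    let ?c = "\<lambda>x. ?r\<^sup>* `` {x}"
    have Lc: "(map_rel \<phi> \<alpha> ?L)\<^sup>* `` {x} = ?c x" if x: "x \<in> ?L" for x
    proof (intro equalityI subsetI)
      fix y assume "y \<in> (map_rel \<phi> \<alpha> ?L)\<^sup>* `` {x}"
      moreover have "(map_rel \<phi> \<alpha> ?L)\<^sup>* \<subseteq> ?r\<^sup>*" by (rule rtrancl_mono) (auto simp: map_rel_def)
      ultimately show "y \<in> ?c x" by auto
    next
      fix y assume "y \<in> ?c x"
      then have "(x, y) \<in> ?r\<^sup>*" by simp
      then have "(x, y) \<in> (map_rel \<phi> \<alpha> ?L)\<^sup>*"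
      proof (induction rule: rtrancl_induct)
        case (step y z)
        then have "y \<in> ?L" using map_rel_closed[OF step.hyps(1) x perm_on_in[OF \<phi>L] perm_on_in[OF \<open>perm_on \<alpha> ?L\<close>]] by simp
        then have "(y, z) \<in> map_rel \<phi> \<alpha> ?L" using step.hyps(2) by (auto simp: map_rel_def)
        then show ?case using step by (meson rtrancl.rtrancl_into_rtrancl)
      qed simp
      then show "y \<in> (map_rel \<phi> \<alpha> ?L)\<^sup>* `` {x}" by simp
    qed
    have "(\<lambda>x. (map_rel \<phi> \<alpha> ?L)\<^sup>* `` {x}) ` ?L = ?c ` ?L" by (rule image_cong) (use Lc in auto)
    then have eq: "num_comps (map_rel \<phi> \<alpha> ?L) ?L = card (?c ` ?L)" by (simp add: num_comps_def)
    have "K \<notin> ?c ` ?L" by auto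
    moreover have fin: "finite (?c ` ?L)" using perm_on_finite[OF \<phi>] by simp
    ultimately have "card (insert K (?c ` ?L)) = card (?c ` ?L) + 1" by simp
    moreover have "card (insert K (?c ` ?L)) \<le> num_comps ?r S"
      unfolding num_comps_def
      by (rule card_mono) (use perm_on_finite[OF \<phi>] o in \<open>auto simp: K_def\<close>)
    ultimately show ?thesis using eq by simp
  qed
  have "card S = card K + card ?L"
    using KS perm_on_finite[OF \<phi>] by (metis card_Diff_subset card_mono finite_subset le_add_diff_inverse)
  moreover have "num_orbits \<phi> S = num_orbits \<phi> K + num_orbits \<phi> ?L"
    by (rule num_orbits_split[OF \<phi> KS K\<phi>])
  moreover have "num_orbits (\<phi> \<circ> \<alpha>) S = num_orbits (\<phi> \<circ> \<alpha>) K + num_orbits (\<phi> \<circ> \<alpha>) ?L"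
    by (rule num_orbits_split[OF perm_on_comp[OF \<phi> \<alpha>p] KS]) (simp add: K\<phi> K\<alpha>)
  ultimately show "4 + card K = 2 * (num_orbits (\<phi> \<circ> \<alpha>) K + num_orbits \<phi> K)"
    using planar genus_nonneg_fpf[OF \<phi>K \<alpha>K] genus_nonneg_fpf[OF \<phi>L \<alpha>L] nK nS
    by (simp add: genus_zero_def)
qed

section \<open>Cancelling a pair of mirror triangles\<close>

lemma set_face_path:
  assumes "perm_on (nxt D) S" "d \<in> S"
  shows "set (face_path D d) = orbit (nxt D) d"
proof -
  let ?n = "funpow_dist1 (nxt D) d d"
  have d: "d \<in> orbit (nxt D) d" by (rule self_in_perm_orbit[OF assms])
  note orb = orbit_conv_funpow_dist1[OF d]
  have c: "card (orbit (nxt D) d) = ?n"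
    using card_image[OF inj_on_funpow_dist1[OF d]] by (simp only: orb card_atLeastLessThan)
  show ?thesis unfolding face_path_def set_map set_upt c by (rule orb[symmetric])
qed

lemma euler_numbers:
  assumes \<phi>: "perm_on (nxt D) (darts D)" and \<alpha>: "fpf_involution (opp D) (darts D)"
    and d: "d \<in> darts D" "outer D = face_path D d"
  shows "num_vertices D = num_orbits (nxt D \<circ> opp D) (darts D)"
    "2 * num_edges D = card (darts D)" "area D + 1 = num_orbits (nxt D) (darts D)"
proof -
  have fin: "finite (darts D)" by (rule perm_on_finite[OF \<phi>])
  show "num_vertices D = num_orbits (nxt D \<circ> opp D) (darts D)"
    using d by (auto simp: num_vertices_def num_orbits_def start_vertex_def[abs_def])
  let ?C = "(\<lambda>d. {d, opp D d}) ` darts D"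
  have U: "\<Union> ?C = darts D" using fpf_involutionD(1)[OF \<alpha>] by auto
  have "2 * card ?C = card (\<Union> ?C)"
  proof (rule card_partition)
    show "card c = 2" if "c \<in> ?C" for c
      using that fpf_involutionD(2)[OF \<alpha>] by (auto simp: card_2_iff)
    show "c1 \<inter> c2 = {}" if c: "c1 \<in> ?C" "c2 \<in> ?C" "c1 \<noteq> c2" for c1 c2
    proof (rule ccontr)
      assume "c1 \<inter> c2 \<noteq> {}"
      then obtain z where z: "z \<in> c1" "z \<in> c2" by blast
      have "c = {z, opp D z}" if "c \<in> ?C" "z \<in> c" for c
        using that fpf_involutionD(3)[OF \<alpha>] by auto
      then show False using c z by metis
    qed
  qed (use fin U in auto)
  then show "2 * num_edges D = card (darts D)" by (simp only: U num_edges_def)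
  have out: "set (outer D) = orbit (nxt D) d" using set_face_path[OF \<phi> d(1)] d by simp
  have eq: "orbit (nxt D) x = orbit (nxt D) d" if "x \<in> orbit (nxt D) d" for x
    by (rule perm_orbit_eq[OF \<phi> d(1) that])
  have "orbit (nxt D) ` darts D = insert (orbit (nxt D) d) (orbit (nxt D) ` inner_darts D)"
    using eq d unfolding inner_darts_def out by blast
  moreover have "orbit (nxt D) d \<notin> orbit (nxt D) ` inner_darts D"
    using self_in_perm_orbit[OF \<phi>] out by (auto simp: inner_darts_def)
  moreover have "finite (orbit (nxt D) ` inner_darts D)" using fin by (simp add: inner_darts_def)
  ultimately show "area D + 1 = num_orbits (nxt D) (darts D)"
    by (simp add: num_orbits_def area_def)
qed

lemma inv_letter_inv_letter [simp]: "inv_letter (inv_letter x) = x"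
  by (simp add: inv_letter_def)

lemma reglue_label:
  assumes \<alpha>: "fpf_involution \<alpha> S" and fg: "f \<in> S" "g \<in> S" and lab: "\<And>x. x \<in> S \<Longrightarrow> l (\<alpha> x) = inv_letter (l x)"
    and g: "l g = l (\<alpha> f)" and x: "x \<in> S"
  shows "l (reglue \<alpha> f g x) = inv_letter (l x)"
proof -
  let ?t = "transpose g (\<alpha> f)"
  have t: "l (?t y) = l y" for y using g by (simp add: transpose_def)
  have "perm_on ?t S"
    using perm_on_transpose fg fpf_involutionD(1)[OF \<alpha> fg(1)] \<alpha> by (metis fpf_involution_def)
  then have "?t x \<in> S" using x by (rule perm_on_in)
  then show ?thesis by (simp add: reglue_def t lab)
qed

lemma no_mirror_triangles:
  assumes min: "minimal_diagram S R w D" and e: "e \<in> inner_darts D" "opp D e \<in> inner_darts D"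
    and tri: "f = nxt D e" "g = nxt D f" "nxt D g = e"
    and tri': "f' = nxt D (opp D e)" "g' = nxt D f'" "nxt D g' = opp D e"
    and dist: "distinct [e, f, g, opp D e, f', g']"
    and mirror: "lab D f' = inv_letter (lab D g)" "lab D g' = inv_letter (lab D f)"
  shows False
proof -
  let ?M = "darts D" and ?\<phi> = "nxt D" and ?\<alpha> = "opp D"
  have vk: "van_kampen_diagram S R w D" using min by (simp add: minimal_diagram_def)
  then have pc: "planar_complex D" by (simp add: van_kampen_diagram_def)
  have fin: "finite ?M" and perm: "?\<phi> permutes ?M" using pc by (auto simp: planar_complex_def)
  have \<phi>: "perm_on ?\<phi> ?M"
    using perm fin permutes_in_image[OF perm] permutes_inj_on[OF perm] by (auto intro: perm_onI)
  have \<alpha>: "fpf_involution ?\<alpha> ?M" using pc by (auto simp: planar_complex_def fpf_involution_def)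
  have eM: "e \<in> ?M" using e by (simp add: inner_darts_def)
  then obtain d where d: "d \<in> ?M" "outer D = face_path D d"
    using pc by (auto simp: planar_complex_def split: if_splits)
  have out: "set (outer D) = orbit ?\<phi> d" using set_face_path[OF \<phi> d(1)] d by simp
  note eul = euler_numbers[OF \<phi> \<alpha> d]
  have conn: "(x, y) \<in> (map_rel ?\<phi> ?\<alpha> ?M)\<^sup>*" if "x \<in> ?M" "y \<in> ?M" for x y
    using pc that by (auto simp: planar_complex_def map_rel_def)
  have cls: "(map_rel ?\<phi> ?\<alpha> ?M)\<^sup>* `` {x} = ?M" if x: "x \<in> ?M" for x
    using conn[OF x] map_rel_closed[OF _ x perm_on_in[OF \<phi>] fpf_involutionD(1)[OF \<alpha>]] by auto
  have "(\<lambda>x. (map_rel ?\<phi> ?\<alpha> ?M)\<^sup>* `` {x}) ` ?M = {?M}" using cls d(1) by auto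
  then have nc: "num_comps (map_rel ?\<phi> ?\<alpha> ?M) ?M = 1" by (simp add: num_comps_def)
  have euler: "int (num_vertices D) - int (num_edges D) + int (area D) = 1"
    using pc by (simp add: planar_complex_def)
  from euler have "num_vertices D + area D = num_edges D + 1" by linarith
  then have g0: "genus_zero ?\<phi> ?\<alpha> ?M"
    using eul(2) nc by (simp flip: eul(1,3) add: genus_zero_def)
  define e' where "e' = ?\<alpha> e"
  have e': "?\<alpha> e = e'" "?\<alpha> e' = e" "e' \<in> ?M" "?\<phi> g' = e'" "f' = ?\<phi> e'"
    using fpf_involutionD[OF \<alpha> eM] tri' by (auto simp: e'_def)
  have in_M: "f \<in> ?M" "g \<in> ?M" "f' \<in> ?M" "g' \<in> ?M"
    using perm_on_in[OF \<phi>] eM e'(3) tri e'(5) tri'(2) by auto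
  have ne: "distinct [e, f, g, e', f', g']" using dist by (simp add: e'_def)
  note a = fpf_involutionD(3)[OF \<alpha>]
  define \<alpha>1 where "\<alpha>1 = reglue ?\<alpha> f g'"
  define \<alpha>2 where "\<alpha>2 = reglue \<alpha>1 f' g"
  have fpf1: "fpf_involution \<alpha>1 ?M" unfolding \<alpha>1_def by (rule fpf_involution_reglue[OF \<alpha> in_M(1,4)])
  note a1 = fpf_involutionD(3)[OF fpf1]
  have fg': "f \<noteq> g'" using ne by auto
  have val1: "\<alpha>1 f = g'" "\<alpha>1 g' = f"
    using reglue_values(1)[OF \<alpha> in_M(1,4) fg'] a1[OF in_M(1)] by (auto simp: \<alpha>1_def)
  have "e \<notin> {f, g', ?\<alpha> f, ?\<alpha> g'}" using ne a[OF in_M(1)] a[OF in_M(4)] e'(1) by auto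
  then have e1: "\<alpha>1 e = e'" "\<alpha>1 e' = e"
    using reglue_values(2)[OF \<alpha> in_M(1,4) fg' eM] a1[OF eM] e'(1) by (auto simp: \<alpha>1_def)
  have fpf2: "fpf_involution \<alpha>2 ?M" unfolding \<alpha>2_def by (rule fpf_involution_reglue[OF fpf1 in_M(3,2)])
  note a2 = fpf_involutionD(3)[OF fpf2]
  have f'g: "f' \<noteq> g" using ne by auto
  have val2: "\<alpha>2 f' = g" "\<alpha>2 g = f'"
    using reglue_values(1)[OF fpf1 in_M(3,2) f'g] a2[OF in_M(3)] by (auto simp: \<alpha>2_def)
  have keep: "\<alpha>2 x = \<alpha>1 x" if "x \<in> ?M" "x \<noteq> f'" "x \<noteq> g" "\<alpha>1 x \<noteq> f'" "\<alpha>1 x \<noteq> g" for x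
    using reglue_values(2)[OF fpf1 in_M(3,2) f'g that(1)] a1[OF in_M(2)] a1[OF in_M(3)] that
    by (auto simp: \<alpha>2_def)
  have val3: "\<alpha>2 e = e'" "\<alpha>2 e' = e" "\<alpha>2 f = g'" "\<alpha>2 g' = f"
    using keep[of e] keep[of e'] keep[of f] keep[of g'] ne e1 val1 in_M eM e'(3) by auto
  have "f \<in> orbit (?\<phi> \<circ> ?\<alpha>) (?\<alpha> g')"
    using orbit.step[OF orbit.base, of "?\<phi> \<circ> ?\<alpha>" "?\<alpha> g'"] a[OF in_M(4)] e' tri(1) by simp
  then have g1: "genus_zero ?\<phi> \<alpha>1 ?M"
    unfolding \<alpha>1_def by (rule genus_zero_reglue[OF \<phi> \<alpha> in_M(1,4) fg' _ g0])
  have "f' \<in> orbit (?\<phi> \<circ> \<alpha>1) (\<alpha>1 g)"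
    using orbit.step[OF orbit.base, of "?\<phi> \<circ> \<alpha>1" "\<alpha>1 g"] a1[OF in_M(2)] e1 e'(5) tri(3) by simp
  then have g2: "genus_zero ?\<phi> \<alpha>2 ?M"
    unfolding \<alpha>2_def by (rule genus_zero_reglue[OF \<phi> fpf1 in_M(3,2) f'g _ g1])
  have lab0: "lab D (?\<alpha> x) = inv_letter (lab D x)" if "x \<in> ?M" for x
    using vk that by (simp add: van_kampen_diagram_def)
  have lab1: "lab D (\<alpha>1 x) = inv_letter (lab D x)" if "x \<in> ?M" for x
    unfolding \<alpha>1_def by (rule reglue_label[where l = "lab D", OF \<alpha> in_M(1,4) lab0 _ that]) (simp_all add: lab0 in_M mirror)
  have lab2: "lab D (\<alpha>2 x) = inv_letter (lab D x)" if "x \<in> ?M" for x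
    unfolding \<alpha>2_def by (rule reglue_label[where l = "lab D", OF fpf1 in_M(3,2) lab1 _ that]) (simp_all add: lab1 in_M mirror)
  define K where "K = (map_rel ?\<phi> \<alpha>2 ?M)\<^sup>* `` {d}"
  note comp = genus_zero_component[OF \<phi> fpf2 g2 d(1), folded K_def]
  have dK: "d \<in> K" by (simp add: K_def)
  let ?T = "{e, f, g, e', f', g'}"
  have eK: "e \<notin> K"
  proof
    assume "e \<in> K"
    then have "(d, e) \<in> (map_rel ?\<phi> \<alpha>2 ?M)\<^sup>*" by (simp add: K_def)
    then have "(e, d) \<in> (map_rel ?\<phi> \<alpha>2 ?M)\<^sup>*"
      using sym_map_rel[OF \<phi> fpf_involution_perm[OF fpf2]] by (simp add: sym_def)
    then have "d \<in> ?T"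
      by (rule map_rel_closed) (use val2 val3 tri tri' e' in auto)
    then have "e \<in> orbit ?\<phi> d \<or> e' \<in> orbit ?\<phi> d"
      using self_in_perm_orbit[OF \<phi> d(1)] orbit.base[of ?\<phi> d] orbit.step[OF orbit.base, of ?\<phi> d] tri tri' e'
      by auto
    then show False using e out e'(1) by (auto simp: inner_darts_def)
  qed
  define D' where "D' = \<lparr>darts = K, opp = \<alpha>2, nxt = (\<lambda>x. if x \<in> K then ?\<phi> x else x),
    lab = lab D, outer = outer D\<rparr>"
  have sel: "darts D' = K" "opp D' = \<alpha>2" "lab D' = lab D" "outer D' = outer D"
    "\<And>x. x \<in> K \<Longrightarrow> nxt D' x = ?\<phi> x" "\<And>x. x \<notin> K \<Longrightarrow> nxt D' x = x"
    by (auto simp: D'_def)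
  have \<phi>K: "perm_on ?\<phi> K" by (rule perm_on_subset[OF \<phi> comp(1,2)])
  have \<phi>': "perm_on (nxt D') K"
    using \<phi>K comp(2) by (auto simp: perm_on_def sel inj_on_def)
  have \<alpha>': "fpf_involution (opp D') K"
    using fpf2 comp(1,3) finite_subset[OF comp(1) fin] by (auto simp: fpf_involution_def sel)
  have orb: "orbit (nxt D') x = orbit ?\<phi> x" if "x \<in> K" for x
    by (rule orbit_agree[of K]) (use that sel comp(2) in auto)
  have path: "face_path D' x = face_path D x" if x: "x \<in> K" for x
  proof -
    have "(nxt D' ^^ i) x = (?\<phi> ^^ i) x \<and> (?\<phi> ^^ i) x \<in> K" for i
      by (induction i) (use x sel comp(2) in auto)
    then show ?thesis by (simp add: face_path_def orb[OF x])
  qed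
  have d': "d \<in> darts D'" "outer D' = face_path D' d" using dK d(2) path[OF dK] by (auto simp: sel)
  note eul' = euler_numbers[of D', unfolded sel(1), OF \<phi>' \<alpha>' d'[unfolded sel(1)]]
  have n1: "num_orbits (nxt D' \<circ> opp D') K = num_orbits (?\<phi> \<circ> \<alpha>2) K"
    by (rule num_orbits_agree) (auto simp: sel comp(2,3))
  have n2: "num_orbits (nxt D') K = num_orbits ?\<phi> K"
    by (rule num_orbits_agree) (auto simp: sel comp(2,3))
  have "planar_complex D'"
    unfolding planar_complex_def
  proof (intro conjI)
    show "finite (darts D')" using finite_subset[OF comp(1) fin] by (simp add: sel)
    show "\<forall>d\<in>darts D'. opp D' d \<in> darts D' \<and> opp D' d \<noteq> d \<and> opp D' (opp D' d) = d"
      using \<alpha>' by (simp add: fpf_involution_def sel)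
    show "nxt D' permutes darts D'"
      by (rule bij_imp_permutes) (use \<phi>' perm_on_image[OF \<phi>'] in \<open>auto simp: bij_betw_def perm_on_def sel\<close>)
    have "{(x, y). x \<in> darts D' \<and> (y = opp D' x \<or> y = nxt D' x)} = map_rel ?\<phi> \<alpha>2 K"
      by (auto simp: map_rel_def sel)
    then show "\<forall>d\<in>darts D'. \<forall>e\<in>darts D'.
        (d, e) \<in> {(x, y). x \<in> darts D' \<and> (y = opp D' x \<or> y = nxt D' x)}\<^sup>*"
      using comp(4) by (simp add: sel)
    show "if darts D' = {} then outer D' = [] else \<exists>d\<in>darts D'. outer D' = face_path D' d"
      using d' by auto
    show "int (num_vertices D') - int (num_edges D') + int (area D') = 1"
      using comp(5) by (simp flip: n1 n2 eul')
  qed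
  moreover have "x \<in> inner_darts D \<and> face_path D' x = face_path D x" if "x \<in> inner_darts D'" for x
    using comp(1) that path[of x] by (auto simp: inner_darts_def sel)
  ultimately have "van_kampen_diagram S R w D'"
    using vk lab2 subsetD[OF comp(1)] unfolding van_kampen_diagram_def sel by simp
  then have "area D \<le> area D'" using min by (simp add: minimal_diagram_def)
  moreover have "num_orbits ?\<phi> K < num_orbits ?\<phi> ?M"
    unfolding num_orbits_def
  proof (rule psubset_card_mono)
    have "orbit ?\<phi> e \<notin> orbit ?\<phi> ` K"
      using self_in_perm_orbit[OF \<phi> eM] perm_on_orbit_subset[OF \<phi>K] eK by blast
    then show "orbit ?\<phi> ` K \<subset> orbit ?\<phi> ` ?M" using comp(1) eM by blast
  qed (use fin in simp)
  ultimately show False by (simp flip: eul(3) eul'(3) n2)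
qed

section \<open>The free group of reduced words\<close>

definition cons_red :: "'g letter \<Rightarrow> 'g word \<Rightarrow> 'g word" where
  "cons_red x w = (case w of [] \<Rightarrow> [x] | y # v \<Rightarrow> if y = inv_letter x then v else x # w)"

definition reduce :: "'g word \<Rightarrow> 'g word" where
  "reduce w = foldr cons_red w []"

lemma freely_reduced_tl: "freely_reduced (x # w) \<Longrightarrow> freely_reduced w"
  by (cases w) (auto simp: freely_reduced_def)

lemma freely_reduced_cons_red: "freely_reduced w \<Longrightarrow> freely_reduced (cons_red x w)"
  by (cases w) (auto simp: cons_red_def freely_reduced_def dest: freely_reduced_tl[unfolded freely_reduced_def])

lemma cons_red_reduced: "freely_reduced (x # w) \<Longrightarrow> cons_red x w = x # w"
  by (cases w) (auto simp: cons_red_def freely_reduced_def)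

lemma cons_red_cancel:
  assumes "freely_reduced w"
  shows "cons_red x (cons_red (inv_letter x) w) = w"
proof (cases w)
  case (Cons y v)
  then show ?thesis using assms cons_red_reduced[of y v] by (auto simp: cons_red_def)
qed (simp add: cons_red_def)

lemma freely_reduced_foldr: "freely_reduced b \<Longrightarrow> freely_reduced (foldr cons_red w b)"
  by (induction w) (auto intro: freely_reduced_cons_red)

lemma freely_reduced_reduce: "freely_reduced (reduce w)"
  unfolding reduce_def by (rule freely_reduced_foldr) (simp add: freely_reduced_def)

lemma reduce_id: "freely_reduced w \<Longrightarrow> reduce w = w"
proof (induction w)
  case (Cons x w)
  then have "foldr cons_red w [] = w" using freely_reduced_tl[OF Cons.prems] by (simp add: reduce_def)
  then show ?case using cons_red_reduced[OF Cons.prems] by (simp add: reduce_def)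
qed (simp add: reduce_def)

lemma foldr_cons_red:
  assumes "freely_reduced b"
  shows "foldr cons_red (cons_red x v) b = cons_red x (foldr cons_red v b)"
proof (cases v)
  case (Cons y u)
  have "cons_red x (y # u) = (if y = inv_letter x then u else x # y # u)"
    by (simp add: cons_red_def)
  then show ?thesis
    using cons_red_cancel[OF freely_reduced_foldr[OF assms], of x u] Cons by simp
qed (simp add: cons_red_def)

lemma foldr_reduce: "freely_reduced b \<Longrightarrow> foldr cons_red (reduce u) b = foldr cons_red u b"
  by (induction u) (auto simp: reduce_def foldr_cons_red)

lemma reduce_append: "reduce (reduce u @ reduce v) = reduce (u @ v)"
proof -
  have "reduce (reduce u @ reduce v) = foldr cons_red (reduce u) (reduce (reduce v))"
    by (simp add: reduce_def)
  also have "\<dots> = foldr cons_red u (reduce v)"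
    by (simp add: foldr_reduce freely_reduced_reduce reduce_id)
  finally show ?thesis by (simp add: reduce_def)
qed

lemma length_reduce: "length (reduce w) \<le> length w"
proof (induction w)
  case (Cons x w)
  have "length (cons_red x (reduce w)) \<le> Suc (length (reduce w))"
    by (cases "reduce w") (auto simp: cons_red_def)
  then show ?case using Cons by (simp add: reduce_def)
qed (simp add: reduce_def)

typedef 'g fgroup = "{w :: 'g word. freely_reduced w}"
  morphisms rep_fg abs_fg
  by (rule exI[of _ "[]"]) (simp add: freely_reduced_def)

definition fg :: "'g word \<Rightarrow> 'g fgroup" where
  "fg w = abs_fg (reduce w)"

lemma rep_fg_reduced: "freely_reduced (rep_fg a)"
  using rep_fg[of a] by simp

lemma rep_fg_fg: "rep_fg (fg w) = reduce w"
  by (simp add: fg_def abs_fg_inverse freely_reduced_reduce)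

lemma fg_rep_fg: "fg (rep_fg a) = a"
  by (simp add: fg_def reduce_id rep_fg_reduced rep_fg_inverse)

instantiation fgroup :: (type) group_add
begin

definition "0 = fg []"
definition "a + b = fg (rep_fg a @ rep_fg b)"
definition "- a = fg (inv_word (rep_fg a))"
definition "(a :: 'a fgroup) - b = a + - b"

lemma fg_append: "fg (u @ v) = fg u + fg v"
  unfolding plus_fgroup_def rep_fg_fg by (simp add: fg_def reduce_append)

lemma fg_inv_word: "fg (inv_word u @ u) = 0"
proof (induction u)
  case (Cons x u)
  have "fg [inv_letter x, x] = 0"
    by (simp add: fg_def reduce_def cons_red_def zero_fgroup_def)
  moreover have "inv_word (x # u) @ x # u = inv_word u @ [inv_letter x, x] @ u"
    by (simp add: inv_word_def)
  ultimately have "fg (inv_word (x # u) @ x # u) = fg (inv_word u) + (0 + fg u)"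
    by (simp only: fg_append)
  also have "\<dots> = fg (inv_word u @ [] @ u)"
    by (simp only: zero_fgroup_def fg_append)
  finally show ?case using Cons by simp
qed (simp add: inv_word_def zero_fgroup_def)

instance
proof
  fix a b c :: "'a fgroup"
  obtain u v z where [simp]: "a = fg u" "b = fg v" "c = fg z" by (metis fg_rep_fg)
  show "a + b + c = a + (b + c)" by (simp flip: fg_append)
  show "0 + a = a" "a + 0 = a" by (simp_all add: zero_fgroup_def flip: fg_append)
  have "- a + a = fg (inv_word (rep_fg a) @ rep_fg a)"
    by (simp only: fg_append fg_rep_fg uminus_fgroup_def)
  then show "- a + a = 0" by (simp add: fg_inv_word)
qed (simp add: minus_fgroup_def)

end

lemma fg_Nil [simp]: "fg [] = 0"
  by (simp add: zero_fgroup_def)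

lemma fg_Cons: "fg (x # w) = fg [x] + fg w"
  using fg_append[of "[x]" w] by simp

definition gen_fg :: "'g \<Rightarrow> 'g fgroup" where
  "gen_fg x = fg [(x, True)]"

lemma fg_letter: "fg [(x, b)] = (if b then gen_fg x else - gen_fg x)"
proof -
  have "fg [(x, False)] + gen_fg x = 0"
    unfolding gen_fg_def fg_append[symmetric]
    by (simp add: fg_def reduce_def cons_red_def inv_letter_def zero_fgroup_def)
  then have "fg [(x, False)] = - gen_fg x" by (rule eq_neg_iff_add_eq_0[THEN iffD2])
  then show ?thesis by (simp add: gen_fg_def)
qed

definition fnorm :: "'g fgroup \<Rightarrow> nat" where
  "fnorm a = length (rep_fg a)"

lemma fnorm_fg_le: "fnorm (fg w) \<le> length w"
  by (simp add: fnorm_def rep_fg_fg length_reduce)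

lemma fnorm_fg: "freely_reduced w \<Longrightarrow> fnorm (fg w) = length w"
  by (simp add: fnorm_def rep_fg_fg reduce_id)

lemma fnorm_zero [simp]: "fnorm 0 = 0"
  using fnorm_fg_le[of "[]"] by simp

lemma fnorm_add: "fnorm (a + b) \<le> fnorm a + fnorm b"
  using fnorm_fg_le[of "rep_fg a @ rep_fg b"] by (simp add: plus_fgroup_def fnorm_def)

lemma fnorm_minus: "fnorm (- a) \<le> fnorm a"
  using fnorm_fg_le[of "inv_word (rep_fg a)"] by (simp add: uminus_fgroup_def fnorm_def inv_word_def)

lemma fnorm_diff: "fnorm (a - b) \<le> fnorm a + fnorm b"
  using fnorm_add[of a "- b"] fnorm_minus[of b] by simp

lemma fnorm_gen: "fnorm (gen_fg x) \<le> 1"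
  unfolding gen_fg_def using fnorm_fg_le[of "[(x, True)]"] by simp

definition letter_sum :: "('g \<Rightarrow> 'h :: group_add) \<Rightarrow> 'g word \<Rightarrow> 'h" where
  "letter_sum f w = (\<Sum>x\<leftarrow>w. if snd x then f (fst x) else - f (fst x))"

definition fg_hom :: "('g \<Rightarrow> 'h :: group_add) \<Rightarrow> 'g fgroup \<Rightarrow> 'h" where
  "fg_hom f a = letter_sum f (rep_fg a)"

lemma letter_sum_reduce: "letter_sum f (reduce w) = letter_sum f w"
proof (induction w)
  case (Cons x w)
  have "letter_sum f (cons_red x v) = letter_sum f (x # v)" for v
  proof (cases v)
    case (Cons y u)
    then show ?thesis
      by (auto simp: cons_red_def letter_sum_def inv_letter_def simp flip: add.assoc)
  qed (simp add: cons_red_def)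
  then show ?case using Cons by (simp add: reduce_def letter_sum_def)
qed (simp add: reduce_def)

lemma fg_hom_fg: "fg_hom f (fg w) = letter_sum f w"
  by (simp add: fg_hom_def rep_fg_fg letter_sum_reduce)

lemma fg_hom_add: "fg_hom f (a + b) = fg_hom f a + fg_hom f b"
  by (simp add: plus_fgroup_def fg_hom_fg) (simp add: fg_hom_def letter_sum_def)

lemma fg_hom_zero [simp]: "fg_hom f 0 = 0"
  using fg_hom_fg[of f "[]"] by (simp add: letter_sum_def)

lemma fg_hom_minus: "fg_hom f (- a) = - fg_hom f a"
  by (rule eq_neg_iff_add_eq_0[THEN iffD2]) (simp flip: fg_hom_add)

lemma fg_hom_diff: "fg_hom f (a - b) = fg_hom f a - fg_hom f b"
  using fg_hom_add[of f a "- b"] by (simp add: fg_hom_minus)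

lemma fg_hom_gen [simp]: "fg_hom f (gen_fg x) = f x"
  by (simp add: gen_fg_def fg_hom_fg letter_sum_def)

lemma fg_hom_sum_list: "fg_hom f (sum_list as) = sum_list (map (fg_hom f) as)"
  by (induction as) (simp_all add: fg_hom_add)

lemma fgroup_eq_onI:
  assumes "\<And>a b. F (a + b) = F a + F b" "\<And>a b. G (a + b) = G a + G b"
    and "\<And>x. F (gen_fg x) = (G (gen_fg x) :: 'h :: group_add)"
  shows "F a = G a"
proof -
  have zero: "H 0 = 0" if "\<And>a b. H (a + b) = H a + H b" for H :: "'a fgroup \<Rightarrow> 'h"
    using that[of 0 0] add_left_cancel[of "H 0" "H 0" 0] by simp
  have minus: "H (- a) = - H a" if "\<And>a b. H (a + b) = H a + H b" for H :: "'a fgroup \<Rightarrow> 'h" and a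
    using that[of "- a" a] zero[OF that] by (simp add: eq_neg_iff_add_eq_0)
  have "F (fg w) = G (fg w)" for w
  proof (induction w)
    case Nil
    show ?case using zero[of F, OF assms(1)] zero[of G, OF assms(2)] by simp
  next
    case (Cons x w)
    obtain y b where x: "x = (y, b)" by (cases x)
    have "F (fg [x]) = G (fg [x])"
      using minus[of F, OF assms(1)] minus[of G, OF assms(2)] assms(3) by (simp add: x fg_letter)
    then show ?case using Cons by (simp add: fg_Cons[of x w] assms(1,2))
  qed
  then show ?thesis by (metis fg_rep_fg)
qed

definition gpow :: "'h :: group_add \<Rightarrow> int \<Rightarrow> 'h" where
  "gpow a n = (if 0 \<le> n then sum_list (replicate (nat n) a) else - sum_list (replicate (nat (- n)) a))"

lemma gpow_0 [simp]: "gpow a 0 = 0" and gpow_1 [simp]: "gpow a 1 = a"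
  by (simp_all add: gpow_def)

lemma gpow_plus_1: "gpow a (n + 1) = gpow a n + a"
proof -
  have nonneg: "gpow a (n + 1) = gpow a n + a" if n: "0 \<le> n"
  proof -
    have "replicate (nat (n + 1)) a = replicate (nat n) a @ [a]"
      using n by (simp add: nat_add_distrib replicate_append_same)
    then show ?thesis using n by (simp add: gpow_def)
  qed
  have neg: "gpow a (n + 1) = gpow a n + a" if n: "n < 0"
  proof -
    have "nat (- n) = Suc (nat (- (n + 1)))" using n by simp
    then have "- sum_list (replicate (nat (- n)) a) = - sum_list (replicate (nat (- (n + 1))) a) - a"
      by (simp add: minus_add)
    moreover have "gpow a (n + 1) = - sum_list (replicate (nat (- (n + 1))) a)"
      using n by (auto simp: gpow_def)
    ultimately show ?thesis using n by (simp add: gpow_def)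
  qed
  show ?thesis using nonneg neg by linarith
qed

lemma gpow_minus_1: "gpow a (n - 1) = gpow a n - a"
  using gpow_plus_1[of a "n - 1"] by simp

lemma gpow_add: "gpow a (m + n) = gpow a m + gpow a n"
proof (induction n rule: int_induct[of _ 0])
  case (step1 i)
  then show ?case using gpow_plus_1[of a "m + i"] by (simp add: gpow_plus_1 add.assoc)
next
  case (step2 i)
  then show ?case using gpow_minus_1[of a "m + i"] by (simp add: gpow_minus_1 add_diff_eq diff_add_eq)
qed simp

lemma fg_hom_gpow: "fg_hom f (gpow a n) = gpow (fg_hom f a) n"
  by (induction n rule: int_induct[of _ 0])
    (simp_all add: gpow_plus_1 gpow_minus_1 fg_hom_add fg_hom_diff)

lemma gpow_conj: "gpow (c + a - c) n = c + gpow a n - c"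
proof (induction n rule: int_induct[of _ 0])
  case (step1 i)
  then show ?case
    unfolding gpow_plus_1 by (simp add: diff_conv_add_uminus add.assoc del: add_uminus_conv_diff)
next
  case (step2 i)
  then show ?case
    unfolding gpow_minus_1
    by (simp add: diff_conv_add_uminus minus_add add.assoc del: add_uminus_conv_diff)
qed simp

lemma fnorm_gpow_gen: "fnorm (gpow (gen_fg x) n) \<le> nat \<bar>n\<bar>"
proof -
  have "sum_list (replicate m (gen_fg x)) = fg (replicate m (x, True))" for m
    by (induction m) (simp_all add: fg_Cons[of "(x, True)" "replicate m (x, True)" for m] gen_fg_def)
  then have le: "fnorm (sum_list (replicate m (gen_fg x))) \<le> m" for m
    using fnorm_fg_le[of "replicate m (x, True)"] by simp
  then show ?thesis
    using le[of "nat n"] order_trans[OF fnorm_minus le[of "nat (- n)"]]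
    by (simp add: gpow_def abs_if)
qed

section \<open>The monodromy of a corridor\<close>

text \<open>The product starts with a power of the letter \<open>X 0\<close>, which is not a generator of the
  group; it is harmless because it conjugates all letters in the same way.\<close>

primrec pref :: "int \<Rightarrow> nat \<Rightarrow> gen fgroup" where
  "pref j 0 = 0"
| "pref j (Suc n) = pref j n + gpow (gen_fg (X n)) j"

fun theta_gen :: "int \<Rightarrow> gen \<Rightarrow> gen fgroup" where
  "theta_gen j (X i) = pref j i + gen_fg (X i) - pref j i"
| "theta_gen j g = gen_fg g"

definition theta :: "int \<Rightarrow> gen fgroup \<Rightarrow> gen fgroup" where
  "theta j = fg_hom (theta_gen j)"

lemma theta_add: "theta j (a + b) = theta j a + theta j b"
  and theta_minus: "theta j (- a) = - theta j a"
  and theta_diff: "theta j (a - b) = theta j a - theta j b"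
  and theta_sum_list: "theta j (sum_list as) = sum_list (map (theta j) as)"
  and theta_gen: "theta j (gen_fg g) = theta_gen j g"
  by (simp_all add: theta_def fg_hom_add fg_hom_minus fg_hom_diff fg_hom_sum_list)

lemma theta_pref: "theta a (pref b i) = pref (a + b) i - pref a i"
proof (induction i)
  case 0
  show ?case by (simp add: theta_def)
next
  case (Suc i)
  have "theta a (gpow (gen_fg (X i)) b) = pref a i + gpow (gen_fg (X i)) b - pref a i"
    using fg_hom_gpow[of "theta_gen a" "gen_fg (X i)" b] gpow_conj by (simp add: theta_def)
  moreover have "gpow (gen_fg (X i)) b = gpow (gen_fg (X i)) (a + b) - gpow (gen_fg (X i)) a"
    using gpow_add[of "gen_fg (X i)" b a] by (simp add: add.commute)
  ultimately show ?case
    using Suc by (simp add: theta_add diff_conv_add_uminus minus_add add.assoc del: add_uminus_conv_diff)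
qed

lemma theta_theta: "theta a (theta b g) = theta (a + b) g"
proof (rule fgroup_eq_onI[where F = "\<lambda>g. theta a (theta b g)"])
  fix x
  show "theta a (theta b (gen_fg x)) = theta (a + b) (gen_fg x)"
  proof (cases x)
    case (X i)
    show ?thesis
      unfolding X theta_gen theta_gen.simps theta_add theta_diff theta_pref
      by (simp add: diff_conv_add_uminus minus_add add.assoc del: add_uminus_conv_diff)
  qed (simp_all add: theta_gen)
qed (simp_all add: theta_add)

lemma theta_zero: "theta 0 g = g"
proof (rule fgroup_eq_onI[where F = "theta 0"])
  have "pref 0 i = 0" for i by (induction i) simp_all
  then show "theta 0 (gen_fg x) = gen_fg x" for x by (cases x) (simp_all add: theta_gen)
qed (simp_all add: theta_add)

lemma fnorm_pref: "fnorm (pref j i) \<le> i * nat \<bar>j\<bar>"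
proof (induction i)
  case (Suc i)
  then show ?case
    using fnorm_add[of "pref j i" "gpow (gen_fg (X i)) j"] fnorm_gpow_gen[of "X i" j] by simp
qed simp

definition twisted_letters :: "nat \<Rightarrow> nat \<Rightarrow> gen fgroup set" where
  "twisted_letters k n = {b. \<exists>j i. \<bar>j\<bar> \<le> int n \<and> i \<le> k \<and>
     (b = theta j (gen_fg (X i)) \<or> b = - theta j (gen_fg (X i)))}"

definition blocks :: "nat \<Rightarrow> nat \<Rightarrow> nat \<Rightarrow> gen fgroup set" where
  "blocks k N n = {sum_list bs | bs. length bs \<le> N \<and> set bs \<subseteq> twisted_letters k n}"

lemma blocksI: "a = sum_list bs \<Longrightarrow> length bs \<le> N \<Longrightarrow> set bs \<subseteq> twisted_letters k n \<Longrightarrow> a \<in> blocks k N n"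
  by (auto simp: blocks_def)

lemma blocksE:
  assumes "a \<in> blocks k N n"
  obtains bs where "a = sum_list bs" "length bs \<le> N" "set bs \<subseteq> twisted_letters k n"
  using assms by (auto simp: blocks_def)

lemma twisted_letters_mono: "n \<le> m \<Longrightarrow> twisted_letters k n \<subseteq> twisted_letters k m"
  by (force simp: twisted_letters_def)

lemma theta_twisted_letter:
  assumes "b \<in> twisted_letters k n" "\<bar>e\<bar> \<le> 1"
  shows "theta e b \<in> twisted_letters k (Suc n)"
proof -
  obtain j i where ji: "\<bar>j\<bar> \<le> int n" "i \<le> k"
    "b = theta j (gen_fg (X i)) \<or> b = - theta j (gen_fg (X i))"
    using assms(1) by (auto simp: twisted_letters_def)
  then have "\<bar>e + j\<bar> \<le> int (Suc n)" using assms(2) by linarith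
  moreover have "theta e b = theta (e + j) (gen_fg (X i)) \<or> theta e b = - theta (e + j) (gen_fg (X i))"
    using ji(3) by (auto simp: theta_theta theta_minus)
  ultimately show ?thesis using ji(2) unfolding twisted_letters_def by blast
qed

lemma blocks_single:
  assumes "i \<le> k"
  shows "gen_fg (X i) \<in> blocks k 1 0" "- gen_fg (X i) \<in> blocks k 1 0"
proof -
  have "b \<in> blocks k 1 0" if "b = gen_fg (X i) \<or> b = - gen_fg (X i)" for b
  proof (rule blocksI)
    show "set [b] \<subseteq> twisted_letters k 0"
      using that assms by (auto simp: twisted_letters_def theta_zero)
  qed auto
  then show "gen_fg (X i) \<in> blocks k 1 0" "- gen_fg (X i) \<in> blocks k 1 0" by blast+
qed

lemma blocks_zero: "0 \<in> blocks k N n"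
  by (rule blocksI[of _ "[]"]) auto

lemma blocks_add:
  assumes "a \<in> blocks k N n" "b \<in> blocks k M n"
  shows "a + b \<in> blocks k (N + M) n"
proof -
  obtain as where "a = sum_list as" "length as \<le> N" "set as \<subseteq> twisted_letters k n"
    using assms(1) by (rule blocksE)
  moreover obtain bs where "b = sum_list bs" "length bs \<le> M" "set bs \<subseteq> twisted_letters k n"
    using assms(2) by (rule blocksE)
  ultimately show ?thesis by (intro blocksI[of _ "as @ bs"]) auto
qed

lemma blocks_mono: "a \<in> blocks k N n \<Longrightarrow> N \<le> M \<Longrightarrow> n \<le> m \<Longrightarrow> a \<in> blocks k M m"
  using twisted_letters_mono[of n m k] by (elim blocksE) (rule blocksI, auto)

lemma theta_blocks:
  assumes "a \<in> blocks k N n" "\<bar>e\<bar> \<le> 1"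
  shows "theta e a \<in> blocks k N (Suc n)"
proof -
  obtain as where as: "a = sum_list as" "length as \<le> N" "set as \<subseteq> twisted_letters k n"
    using assms(1) by (rule blocksE)
  show ?thesis
  proof (rule blocksI)
    show "theta e a = sum_list (map (theta e) as)" by (simp add: as(1) theta_sum_list)
    show "set (map (theta e) as) \<subseteq> twisted_letters k (Suc n)"
      using as(3) theta_twisted_letter[OF _ assms(2)] by auto
  qed (simp add: as(2))
qed

lemma pref_blocks:
  assumes "i \<le> Suc k"
  shows "pref 1 i \<in> blocks k i 0" "- pref 1 i \<in> blocks k i 0"
proof -
  have "pref 1 i \<in> blocks k i 0 \<and> - pref 1 i \<in> blocks k i 0" using assms
  proof (induction i)
    case (Suc i)
    then have IH: "pref 1 i \<in> blocks k i 0" "- pref 1 i \<in> blocks k i 0" "i \<le> k" by auto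
    have "- pref 1 (Suc i) = - gen_fg (X i) + - pref 1 i" by (simp only: pref.simps gpow_1 minus_add)
    then show ?case
      using blocks_add[OF IH(1) blocks_single(1)[OF IH(3)]] blocks_add[OF blocks_single(2)[OF IH(3)] IH(2)]
      by simp
  qed (simp add: blocks_zero)
  then show "pref 1 i \<in> blocks k i 0" "- pref 1 i \<in> blocks k i 0" by auto
qed

lemma fnorm_blocks:
  assumes "a \<in> blocks k N n"
  shows "fnorm a \<le> N * (2 * k * n + 1)"
proof -
  obtain as where as: "a = sum_list as" "length as \<le> N" "set as \<subseteq> twisted_letters k n"
    using assms by (rule blocksE)
  have one: "fnorm b \<le> 2 * k * n + 1" if b: "b \<in> set as" for b
  proof -
    obtain j i where ji: "\<bar>j\<bar> \<le> int n" "i \<le> k"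
      "b = theta j (gen_fg (X i)) \<or> b = - theta j (gen_fg (X i))"
      using as(3) b unfolding twisted_letters_def by blast
    have "fnorm b \<le> fnorm (theta j (gen_fg (X i)))" using ji(3) fnorm_minus by auto
    also have "\<dots> \<le> fnorm (pref j i) + fnorm (gen_fg (X i)) + fnorm (pref j i)"
      using fnorm_diff[of "pref j i + gen_fg (X i)" "pref j i"] fnorm_add[of "pref j i" "gen_fg (X i)"]
      by (simp add: theta_gen)
    also have "\<dots> \<le> 2 * (i * nat \<bar>j\<bar>) + 1"
      using fnorm_pref[of j i] fnorm_gen[of "X i"] by simp
    also have "\<dots> \<le> 2 * (k * n) + 1" using ji(1,2) by (simp add: mult_le_mono)
    finally show ?thesis by simp
  qed
  have "fnorm (sum_list as) \<le> length as * (2 * k * n + 1)" using one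
  proof (induction as)
    case (Cons b bs)
    have "fnorm (b + sum_list bs) \<le> fnorm b + fnorm (sum_list bs)" by (rule fnorm_add)
    also have "\<dots> \<le> (2 * k * n + 1) + length bs * (2 * k * n + 1)"
      using Cons by (intro add_mono) auto
    finally show ?case by simp
  qed simp
  also have "\<dots> \<le> N * (2 * k * n + 1)" using as(2) by (rule mult_le_mono1)
  finally show ?thesis using as(1) by simp
qed

definition xword :: "nat \<Rightarrow> gen word \<Rightarrow> bool" where
  "xword k w \<longleftrightarrow> fst ` set w \<subseteq> X ` {..k}"

lemma fg_blocks: "xword k w \<Longrightarrow> fg w \<in> blocks k (length w) 0"
proof (induction w)
  case Nil
  then show ?case by (simp add: blocks_zero)
next
  case (Cons x w)
  then obtain i b where x: "x = (X i, b)" "i \<le> k" by (cases x) (auto simp: xword_def)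
  have "fg [x] \<in> blocks k 1 0" using blocks_single[OF x(2)] by (simp add: x(1) fg_letter)
  moreover have "fg w \<in> blocks k (length w) 0" using Cons by (simp add: xword_def)
  ultimately show ?case using blocks_add[of "fg [x]" k 1 0 "fg w" "length w"] by (simp add: fg_Cons[of x w])
qed

text \<open>The relation between the two sides of a corridor: in the semidirect product of the free group
  with a cyclic group acting by \<open>theta 1\<close>, the letters \<open>a\<^sub>i\<close> and \<open>b\<^sub>i\<close>
  are the cyclic generator times \<open>pref 1 i\<close>.\<close>

definition linked :: "nat \<Rightarrow> gen word \<Rightarrow> gen word \<Rightarrow> bool" where
  "linked k u v \<longleftrightarrow> (\<exists>i j. i \<le> Suc k \<and> j \<le> Suc k \<and>
     (theta 1 (fg u) + pref 1 j = pref 1 i + fg v \<or> theta 1 (fg v) + pref 1 j = pref 1 i + fg u))"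

lemma linked_sym: "linked k u v \<Longrightarrow> linked k v u"
  unfolding linked_def by blast

lemma linked_blocks:
  assumes "linked k u v" "fg u \<in> blocks k N n"
  shows "fg v \<in> blocks k (N + 2 * Suc k) (Suc n)"
proof -
  obtain i j where ij: "i \<le> Suc k" "j \<le> Suc k"
    "theta 1 (fg u) + pref 1 j = pref 1 i + fg v \<or> theta 1 (fg v) + pref 1 j = pref 1 i + fg u"
    using assms(1) unfolding linked_def by blast
  have pre: "p + a + q \<in> blocks k (N + 2 * Suc k) m"
    if "a \<in> blocks k N m" "p \<in> {pref 1 i, - pref 1 i}" "q \<in> {pref 1 j, - pref 1 j}" for p q a m
  proof -
    have "p \<in> blocks k (Suc k) m" "q \<in> blocks k (Suc k) m"
      using pref_blocks[OF ij(1)] pref_blocks[OF ij(2)] ij(1,2) that(2,3)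
      by (auto elim!: blocks_mono)
    from blocks_add[OF blocks_add[OF this(1) that(1)] this(2)]
    show ?thesis by (rule blocks_mono) auto
  qed
  from ij(3) show ?thesis
  proof
    assume "theta 1 (fg u) + pref 1 j = pref 1 i + fg v"
    then have "fg v = - pref 1 i + theta 1 (fg u) + pref 1 j" by (simp add: add.assoc)
    then show ?thesis using pre[OF theta_blocks[OF assms(2), of 1]] by simp
  next
    assume "theta 1 (fg v) + pref 1 j = pref 1 i + fg u"
    then have "theta 1 (fg v) = pref 1 i + fg u + - pref 1 j"
      by (metis add_diff_cancel diff_conv_add_uminus)
    then have "theta (- 1) (theta 1 (fg v)) \<in> blocks k (N + 2 * Suc k) (Suc n)"
      using theta_blocks[OF pre[OF assms(2)], of "pref 1 i" "- pref 1 j" "- 1"] by simp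
    then show ?thesis by (simp add: theta_theta theta_zero)
  qed
qed

lemma linked_chain_length:
  assumes "xword k (W 0)" "\<And>i. i < m \<Longrightarrow> linked k (W i) (W (Suc i))" "freely_reduced (W m)"
  shows "length (W m) \<le> (length (W 0) + 2 * Suc k * m) * (2 * k * m + 1)"
proof -
  have "n \<le> m \<Longrightarrow> fg (W n) \<in> blocks k (length (W 0) + 2 * Suc k * n) n" for n
  proof (induction n)
    case 0
    then show ?case using fg_blocks[OF assms(1)] by simp
  next
    case (Suc n)
    then show ?case using linked_blocks[OF assms(2)[of n] Suc.IH] by (simp add: algebra_simps)
  qed
  from fnorm_blocks[OF this[of m]] show ?thesis by (simp add: fnorm_fg assms(3))
qed

text \<open>A triangle of a corridor is recorded as \<open>(i, i', b)\<close>: it is entered through an edge with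
  index \<open>i\<close>, left through one with index \<open>i'\<close>, and \<open>b\<close> tells whether its third
  edge lies on the right side. The Boolean \<open>s\<close> is the orientation of the entrance edges, which is
  constant along the corridor.\<close>

type_synonym step = "nat \<times> nat \<times> bool"

fun step_letter :: "bool \<Rightarrow> step \<Rightarrow> gen letter" where
  "step_letter s (i, i', b) = (X (min i i'), b = (s = (i < i')))"

definition side_word :: "bool \<Rightarrow> bool \<Rightarrow> step list \<Rightarrow> gen word" where
  "side_word s b ps = map (step_letter s) (filter (\<lambda>(i, i', b'). b' = b) ps)"

fun walk :: "nat \<Rightarrow> step list \<Rightarrow> nat \<Rightarrow> bool" where
  "walk j [] j' \<longleftrightarrow> j = j'"
| "walk j ((i, i', b) # ps) j' \<longleftrightarrow> i = j \<and> (i' = Suc i \<or> i = Suc i') \<and> walk i' ps j'"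

fun backtrack :: "step \<Rightarrow> step \<Rightarrow> bool" where
  "backtrack (i, i', b) (j, j', b') \<longleftrightarrow> j = i' \<and> j' = i \<and> b' = b"

abbreviation non_backtracking :: "step list \<Rightarrow> bool" where
  "non_backtracking \<equiv> successively (\<lambda>p q. \<not> backtrack p q)"

lemma walk_append: "walk j (ps @ qs) j' \<longleftrightarrow> (\<exists>i. walk j ps i \<and> walk i qs j')"
  by (induction j ps j' rule: walk.induct) auto

lemma walk_one_sided:
  assumes "walk j (p # ps) j'" "non_backtracking (p # ps)" "\<forall>(i, i', b') \<in> set (p # ps). b' = b"
  shows "j' \<noteq> j"
proof -
  have "if fst (snd p) = Suc j then j < j' else j' < j"
    using assms
  proof (induction ps arbitrary: p j)
    case Nil
    then show ?case by (cases p) auto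
  next
    case (Cons q ps)
    obtain i b1 where p: "p = (j, i, b1)" "i = Suc j \<or> j = Suc i" "walk i (q # ps) j'"
      using Cons.prems(1) by (cases p) auto
    obtain i' b2 where q: "q = (i, i', b2)" "i' = Suc i \<or> i = Suc i'"
      using p(3) by (cases q) auto
    have "b1 = b2" using Cons.prems(3) by (simp add: p q)
    then have "i' \<noteq> j" using Cons.prems(2) by (simp add: p q)
    moreover have "if i' = Suc i then i < j' else j' < i"
      using Cons.IH[OF p(3)] Cons.prems by (simp add: q)
    ultimately show ?case using p(1,2) q(2) by (auto split: if_splits)
  qed
  then show ?thesis by (auto split: if_splits)
qed

text \<open>Two cancelling letters on one side are separated by triangles on the other side only; these
  form a closed walk without backtracking on a line, so there are none.\<close>

lemma freely_reduced_side_word: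
  assumes "walk j ps j'" "non_backtracking ps"
  shows "freely_reduced (side_word s b ps)"
  using assms
proof (induction ps arbitrary: j)
  case Nil
  show ?case by (simp add: side_word_def freely_reduced_def)
next
  case (Cons p ps)
  obtain i b1 where p: "p = (j, i, b1)" "i = Suc j \<or> j = Suc i" "walk i ps j'"
    using Cons.prems(1) by (cases p) auto
  have nb: "non_backtracking ps" using Cons.prems(2) by (auto simp: successively_Cons)
  have IH: "freely_reduced (side_word s b ps)" by (rule Cons.IH[OF p(3) nb])
  show ?case
  proof (cases "b1 = b \<and> side_word s b ps \<noteq> []")
    case False
    then show ?thesis using IH by (auto simp: p side_word_def freely_reduced_def)
  next
    case True
    define other where "other = (\<lambda>(i :: nat, i' :: nat, b'). b' \<noteq> b)"
    have "dropWhile other ps \<noteq> []"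
    proof -
      obtain x where "x \<in> set ps" "case x of (i, i', b') \<Rightarrow> b' = b"
        using True by (auto simp: side_word_def filter_empty_conv)
      then show ?thesis by (force simp: other_def)
    qed
    then obtain q qs where qs: "dropWhile other ps = q # qs" by (cases "dropWhile other ps") auto
    define ts where "ts = takeWhile other ps"
    have ps: "ps = ts @ q # qs" using qs by (metis takeWhile_dropWhile_id ts_def)
    have "\<not> other q" using qs by (metis hd_dropWhile list.sel(1) list.distinct(1))
    then obtain m m' where q: "q = (m, m', b)" by (cases q) (auto simp: other_def)
    have ts: "\<forall>(i, i', b') \<in> set ts. b' = (\<not> b)"
      using set_takeWhileD[of _ other ps] by (fastforce simp: ts_def other_def)
    then have "filter (\<lambda>(i, i', b'). b' = b) ts = []" by (auto simp: filter_empty_conv)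
    then have sw: "side_word s b ps = step_letter s q # side_word s b qs"
      by (simp add: side_word_def ps q)
    have "walk i ts m" "m' = Suc m \<or> m = Suc m'" using p(3) by (auto simp: ps q walk_append)
    have "step_letter s q \<noteq> inv_letter (step_letter s p)"
    proof
      assume "step_letter s q = inv_letter (step_letter s p)"
      then have "min m m' = min j i" "(m < m') = (\<not> j < i)"
        using True by (auto simp: inv_letter_def p q)
      then have mm: "m = i" "m' = j" using p(2) \<open>m' = Suc m \<or> m = Suc m'\<close> by auto
      show False
      proof (cases ts)
        case Nil
        then show False using Cons.prems(2) True mm by (simp add: ps p q)
      next
        case (Cons t us)
        have "non_backtracking ts" using nb by (auto simp: ps successively_append_iff)
        then show False
          using walk_one_sided[of i t us m "\<not> b"] \<open>walk i ts m\<close> ts mm unfolding Cons by simp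
      qed
    qed
    then show ?thesis using IH True sw by (simp add: p side_word_def freely_reduced_def)
  qed
qed

lemma side_word_linked:
  assumes "walk j ps j'"
  shows "theta 1 (fg (side_word s (\<not> s) ps)) + pref 1 j' = pref 1 j + fg (side_word s s ps)"
  using assms
proof (induction ps arbitrary: j)
  case Nil
  then show ?case by (simp add: side_word_def theta_def)
next
  case (Cons p ps)
  obtain i b where p: "p = (j, i, b)" "i = Suc j \<or> j = Suc i" "walk i ps j'"
    using Cons.prems by (cases p) auto
  note IH = Cons.IH[OF p(3)]
  have sw: "side_word s c (p # ps) =
      (if b = c then step_letter s p # side_word s c ps else side_word s c ps)" for c
    by (simp add: side_word_def p(1))
  show ?case
  proof (cases "b = s")
    case True
    have "pref 1 i = pref 1 j + fg [step_letter s p]"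
      using p(2) True by (auto simp: p(1) fg_letter)
    then have "pref 1 j + fg (side_word s s (p # ps)) = pref 1 i + fg (side_word s s ps)"
      unfolding sw using True fg_Cons[of "step_letter s p" "side_word s s ps"]
      by (simp add: add.assoc)
    then show ?thesis unfolding sw[of "\<not> s"] using IH True by simp
  next
    case False
    then have b: "b = (\<not> s)" by simp
    have "theta 1 (fg [step_letter s p]) + pref 1 i = pref 1 j"
      using p(2) b by (auto simp: p(1) fg_letter theta_gen theta_minus add.assoc
        diff_conv_add_uminus minus_add simp del: add_uminus_conv_diff)
    moreover have "fg (side_word s (\<not> s) (p # ps)) = fg [step_letter s p] + fg (side_word s (\<not> s) ps)"
      unfolding sw using b fg_Cons[of "step_letter s p" "side_word s (\<not> s) ps"] by simp
    ultimately have "theta 1 (fg (side_word s (\<not> s) (p # ps))) + pref 1 j' = pref 1 j + fg (side_word s s ps)"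
      using IH by (simp only: theta_add) (metis add.assoc)
    then show ?thesis unfolding sw[of s] using b by simp
  qed
qed

section \<open>Corridors in minimal diagrams\<close>

fun gen_index :: "gen \<Rightarrow> nat" where
  "gen_index (A i) = i" | "gen_index (B i) = i" | "gen_index (X i) = i"

definition corr_step :: "gen diagram \<Rightarrow> gen set \<Rightarrow> nat \<Rightarrow> step" where
  "corr_step D \<tau> d = (gen_index (fst (lab D d)), gen_index (fst (lab D (exit_dart D \<tau> d))),
     \<not> dart_in D \<tau> (nxt D d))"

lemma rotate_triple:
  "rotate n [x, y, z] \<in> {[x, y, z], [y, z, x], [z, x, y]}"
proof -
  have "rotate n [x, y, z] = rotate (n mod 3) [x, y, z]"
    using rotate_conv_mod[of n "[x, y, z]"] by simp
  moreover have "n mod 3 = 0 \<or> n mod 3 = Suc 0 \<or> n mod 3 = Suc (Suc 0)" by linarith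
  moreover have "rotate 0 [x, y, z] = [x, y, z]" "rotate (Suc 0) [x, y, z] = [y, z, x]"
    "rotate (Suc (Suc 0)) [x, y, z] = [z, x, y]" by (simp_all add: rotate_def)
  ultimately show ?thesis by (metis insertCI)
qed

lemma cyclic_triple:
  "[x, y, z] \<in> {[p, q, r], [q, r, p], [r, p, q]} \<Longrightarrow>
    (x, y, z) \<in> {(p, q, r), (q, r, p), (r, p, q)}"
  by simp

lemma face_path_triangle:
  assumes "perm_on (nxt D) S" "d \<in> S" "card (cell D d) = 3"
  shows "face_path D d = [d, nxt D d, nxt D (nxt D d)]" "nxt D (nxt D (nxt D d)) = d"
    "distinct [d, nxt D d, nxt D (nxt D d)]" "cell D d = {d, nxt D d, nxt D (nxt D d)}"
proof -
  show fp: "face_path D d = [d, nxt D d, nxt D (nxt D d)]"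
    by (simp add: face_path_def assms(3) upt_rec numeral_3_eq_3)
  show c: "cell D d = {d, nxt D d, nxt D (nxt D d)}"
    using set_face_path[OF assms(1,2)] fp by simp
  show dist: "distinct [d, nxt D d, nxt D (nxt D d)]"
    using assms(3) c by (intro card_distinct) simp
  have in_S: "nxt D d \<in> S" "nxt D (nxt D d) \<in> S" using perm_on_in[OF assms(1)] assms(2) by auto
  have "nxt D (nxt D (nxt D d)) \<in> cell D d" by (intro orbit.intros)
  moreover have "nxt D (nxt D (nxt D d)) \<noteq> nxt D d" "nxt D (nxt D (nxt D d)) \<noteq> nxt D (nxt D d)"
    using dist in_S assms(2) by (auto simp: perm_on_inj[OF assms(1)])
  ultimately show "nxt D (nxt D (nxt D d)) = d" using c by auto
qed

lemma van_kampen_perm: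
  assumes "van_kampen_diagram S R w D"
  shows "perm_on (nxt D) (darts D)" "d \<in> inner_darts D \<Longrightarrow> nxt D d \<in> inner_darts D"
    "d \<in> darts D \<Longrightarrow> lab D (opp D d) = inv_letter (lab D d)"
    "d \<in> darts D \<Longrightarrow> opp D (opp D d) = d"
proof -
  have pc: "planar_complex D" using assms by (simp add: van_kampen_diagram_def)
  have fin: "finite (darts D)" and perm: "nxt D permutes darts D" using pc by (auto simp: planar_complex_def)
  show \<phi>: "perm_on (nxt D) (darts D)"
    using perm fin permutes_in_image[OF perm] permutes_inj_on[OF perm] by (auto intro: perm_onI)
  show "nxt D d \<in> inner_darts D" if d: "d \<in> inner_darts D"
  proof -
    have dM: "d \<in> darts D" using d by (simp add: inner_darts_def)
    then obtain d0 where d0: "d0 \<in> darts D" "outer D = face_path D d0"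
      using pc by (auto simp: planar_complex_def split: if_splits)
    have out: "set (outer D) = cell D d0" using set_face_path[OF \<phi> d0(1)] d0(2) by simp
    have "nxt D d \<notin> cell D d0"
      using perm_orbit_eq[OF \<phi> d0(1)] perm_orbit_eq[OF \<phi> dM orbit.base] self_in_perm_orbit[OF \<phi> dM] d out
      by (auto simp: inner_darts_def)
    then show ?thesis using perm_on_in[OF \<phi> dM] out by (simp add: inner_darts_def)
  qed
  show "lab D (opp D d) = inv_letter (lab D d)" if "d \<in> darts D"
    using assms that by (simp add: van_kampen_diagram_def)
  show "opp D (opp D d) = d" if "d \<in> darts D"
    using pc that by (simp add: planar_complex_def)
qed

lemma corridor_triangle:
  assumes vk: "van_kampen_diagram (gens k) (relators k) w D" and tri: "tau_triangle D \<tau> d"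
    and c: "c \<in> {A, B}" "\<tau> = c ` {1..k + 1}" and step: "corr_step D \<tau> d = (i, i', b)"
    and s: "s = snd (lab D d)"
  shows "lab D d = (c i, s)" "lab D (exit_dart D \<tau> d) = (c i', \<not> s)"
    "i \<le> Suc k" "i' \<le> Suc k" "min i i' \<le> k" "i' = Suc i \<or> i = Suc i'" "dart_in D \<tau> (nxt D d) = (\<not> b)"
    "exit_dart D \<tau> d = (if b then nxt D (nxt D d) else nxt D d)"
    "b \<Longrightarrow> lab D (nxt D d) = step_letter s (i, i', b)"
    "\<not> b \<Longrightarrow> lab D (nxt D (nxt D d)) = inv_letter (step_letter s (i, i', b))"
proof -
  have d: "d \<in> inner_darts D" "d \<in> darts D" "dart_in D \<tau> d" "card (cell D d) = 3"
    using tri by (auto simp: tau_triangle_def inner_darts_def)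
  note path = face_path_triangle(1)[OF van_kampen_perm(1)[OF vk] d(2,4)]
  let ?L = "map (lab D) [d, nxt D d, nxt D (nxt D d)]"
  obtain r n where r: "r \<in> relators k" "?L = rotate n r \<or> ?L = rotate n (inv_word r)"
    using vk d(1) path unfolding van_kampen_diagram_def by (metis insertE singletonD)
  obtain m c' where m: "1 \<le> m" "m \<le> k" "c' \<in> {A, B}"
    "r = [(c' m, True), (X m, True), (c' (m + 1), False)] \<or>
     r = [(X m, True), (c' m, True), (c' (m + 1), False)]"
  proof -
    obtain m c' where "m \<in> {1..k}" "c' \<in> {A, B}"
      "r \<in> {[(c' m, True), (X m, True), (c' (m + 1), False)],
        [(X m, True), (c' m, True), (c' (m + 1), False)]}"
      using r(1) unfolding relators_def by blast
    then show ?thesis by (intro that[of m c']) auto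
  qed
  define cyc :: "gen letter \<Rightarrow> gen letter \<Rightarrow> gen letter \<Rightarrow> bool" where
    "cyc = (\<lambda>x y z. ?L \<in> {[x, y, z], [y, z, x], [z, x, y]})"
  define tcyc where
    "tcyc = (\<lambda>x y z. (lab D d, lab D (nxt D d), lab D (nxt D (nxt D d))) \<in> {(x, y, z), (y, z, x), (z, x, y)})"
  have iw: "inv_word [(x, True), (y, True), (z, False)] = [(z, True), (y, False), (x, False)]"
    for x y z :: gen by (simp add: inv_word_def inv_letter_def)
  have "cyc (c' m, True) (X m, True) (c' (m + 1), False) \<or>
    cyc (X m, True) (c' m, True) (c' (m + 1), False) \<or>
    cyc (c' (m + 1), True) (X m, False) (c' m, False) \<or>
    cyc (c' (m + 1), True) (c' m, False) (X m, False)"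
    using r(2) m(4) unfolding cyc_def by (elim disjE) (simp_all only: iw rotate_triple simp_thms)
  then have cyc: "tcyc (c' m, True) (X m, True) (c' (m + 1), False) \<or>
    tcyc (X m, True) (c' m, True) (c' (m + 1), False) \<or>
    tcyc (c' (m + 1), True) (X m, False) (c' m, False) \<or>
    tcyc (c' (m + 1), True) (c' m, False) (X m, False)"
    unfolding cyc_def tcyc_def list.map by (elim disj_forward) (erule cyclic_triple)+
  have mem: "c j \<in> \<tau> \<longleftrightarrow> 1 \<le> j \<and> j \<le> k + 1" "X j \<notin> \<tau>" "gen_index (c j) = j" for j
    using c by auto
  have st: "i = gen_index (fst (lab D d))" "i' = gen_index (fst (lab D (exit_dart D \<tau> d)))"
    "b = (\<not> dart_in D \<tau> (nxt D d))"
    using step by (auto simp: corr_step_def)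
  have tau: "fst (lab D d) \<in> \<tau>" using d(3) by (simp add: dart_in_def)
  have "fst (lab D d) \<in> {c' m, X m, c' (m + 1)}"
    using cyc unfolding tcyc_def by (elim disjE insertE emptyE) simp_all
  then have "c' m \<in> \<tau> \<or> c' (m + 1) \<in> \<tau>" using tau mem(2) by auto
  then have c': "c' = c" using c m(3) by auto
  have L: "(lab D d, lab D (nxt D d), lab D (nxt D (nxt D d))) \<in>
     {((c m, True), (X m, True), (c (m + 1), False)),
      ((c (m + 1), False), (c m, True), (X m, True)),
      ((c m, True), (c (m + 1), False), (X m, True)),
      ((c (m + 1), False), (X m, True), (c m, True)),
      ((c (m + 1), True), (X m, False), (c m, False)),
      ((c m, False), (c (m + 1), True), (X m, False)),
      ((c (m + 1), True), (c m, False), (X m, False)),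
      ((c m, False), (X m, False), (c (m + 1), True))}"
    using cyc tau mem(2)[of m] unfolding tcyc_def c' by (elim disjE insertE emptyE) simp_all
  have "lab D d = (c i, s) \<and> lab D (exit_dart D \<tau> d) = (c i', \<not> s) \<and>
    i \<le> Suc k \<and> i' \<le> Suc k \<and> min i i' \<le> k \<and> (i' = Suc i \<or> i = Suc i') \<and>
    dart_in D \<tau> (nxt D d) = (\<not> b) \<and>
    exit_dart D \<tau> d = (if b then nxt D (nxt D d) else nxt D d) \<and>
    (b \<longrightarrow> lab D (nxt D d) = step_letter s (i, i', b)) \<and>
    (\<not> b \<longrightarrow> lab D (nxt D (nxt D d)) = inv_letter (step_letter s (i, i', b)))"
    using L m(1,2) unfolding st s insert_iff empty_iff prod.inject
    by (elim disjE conjE) (simp_all add: mem exit_dart_def dart_in_def inv_letter_def)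
  then show "lab D d = (c i, s)" "lab D (exit_dart D \<tau> d) = (c i', \<not> s)"
    "i \<le> Suc k" "i' \<le> Suc k" "min i i' \<le> k" "i' = Suc i \<or> i = Suc i'" "dart_in D \<tau> (nxt D d) = (\<not> b)"
    "exit_dart D \<tau> d = (if b then nxt D (nxt D d) else nxt D d)"
    "b \<Longrightarrow> lab D (nxt D d) = step_letter s (i, i', b)"
    "\<not> b \<Longrightarrow> lab D (nxt D (nxt D d)) = inv_letter (step_letter s (i, i', b))"
    by blast+
qed

lemma no_backtrack:
  assumes min: "minimal_diagram (gens k) (relators k) w D"
    and tri: "tau_triangle D \<tau> d" "tau_triangle D \<tau> d'" and next_d: "d' = opp D (exit_dart D \<tau> d)"
    and c: "c \<in> {A, B}" "\<tau> = c ` {1..k + 1}"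
  shows "\<not> backtrack (corr_step D \<tau> d) (corr_step D \<tau> d')"
proof
  assume bt: "backtrack (corr_step D \<tau> d) (corr_step D \<tau> d')"
  obtain i i' b where st: "corr_step D \<tau> d = (i, i', b)" by (metis prod_cases3)
  then have st': "corr_step D \<tau> d' = (i', i, b)" using bt by (cases "corr_step D \<tau> d'") auto
  have vk: "van_kampen_diagram (gens k) (relators k) w D" using min by (simp add: minimal_diagram_def)
  note \<phi> = van_kampen_perm(1)[OF vk]
  have d: "d \<in> inner_darts D" "d \<in> darts D" "card (cell D d) = 3"
    and d': "d' \<in> inner_darts D" "d' \<in> darts D" "card (cell D d') = 3"
    using tri by (auto simp: tau_triangle_def inner_darts_def)
  note F = face_path_triangle(2-4)[OF \<phi> d(2,3)] and F' = face_path_triangle(2-4)[OF \<phi> d'(2,3)]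
  define s where "s = snd (lab D d)"
  note t = corridor_triangle[OF vk tri(1) c st s_def]
  define e where "e = exit_dart D \<tau> d"
  have e: "e \<in> inner_darts D" "opp D e = d'" "e \<in> darts D"
    using t(8) van_kampen_perm(2)[OF vk] d(1) next_d by (auto simp: e_def inner_darts_def)
  have labd': "lab D d' = (c i', s)"
    using van_kampen_perm(3)[OF vk e(3)] e(2) t(2) by (simp add: e_def inv_letter_def)
  then have s': "s = snd (lab D d')" by simp
  note t' = corridor_triangle[OF vk tri(2) c st' s']
  have cne: "c i \<noteq> c i'" "c j \<noteq> X m" for j m using t(6) c(1) by auto
  have "d' \<notin> cell D d"
    using F(3) t(1,2,8,9,10) labd' cne by (auto simp: inv_letter_def split: if_splits)
  have disj: "x \<notin> cell D d" if x: "x \<in> cell D d'" for x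
  proof
    assume "x \<in> cell D d"
    then have "cell D d = cell D d'" using perm_orbit_eq[OF \<phi> d(2)] perm_orbit_eq[OF \<phi> d'(2) x] by simp
    then show False using \<open>d' \<notin> cell D d\<close> self_in_perm_orbit[OF \<phi> d'(2)] by simp
  qed
  define f where "f = nxt D e"
  define g where "g = nxt D f"
  define f' where "f' = nxt D d'"
  define g' where "g' = nxt D f'"
  have efg: "(e, f, g) = (if b then (nxt D (nxt D d), d, nxt D d) else (nxt D d, nxt D (nxt D d), d))"
    using t(8) F(1) by (simp add: e_def f_def g_def)
  have "distinct [e, f, g, d', f', g']"
    using efg F(2,3) F'(2,3) disj by (auto simp: f'_def g'_def split: if_splits)
  moreover have "nxt D g = e" using efg F(1) by (auto split: if_splits)
  moreover have "nxt D g' = d'" using F'(1) by (simp add: f'_def g'_def)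
  moreover have "lab D f' = inv_letter (lab D g)" "lab D g' = inv_letter (lab D f)"
    using efg t(1,6,9,10) t'(2,8,9,10)
    by (auto simp: f'_def g'_def inv_letter_def min.commute split: if_splits)
  ultimately show False
    using no_mirror_triangles[OF min e(1), of f g f' g'] d'(1)
    by (simp add: e(2) f_def g_def f'_def g'_def)
qed

lemma corridor_walk:
  assumes min: "minimal_diagram (gens k) (relators k) w D"
    and c: "c \<in> {A, B}" "\<tau> = c ` {1..k + 1}"
    and "\<forall>d\<in>set (d # ds). tau_triangle D \<tau> d"
    and "successively (\<lambda>d e. e = opp D (exit_dart D \<tau> d)) (d # ds)"
  shows "\<exists>j'\<le>Suc k. walk (fst (corr_step D \<tau> d)) (map (corr_step D \<tau>) (d # ds)) j'"
    "non_backtracking (map (corr_step D \<tau>) (d # ds))"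
    "\<forall>e\<in>set (d # ds). snd (lab D e) = snd (lab D d)"
proof -
  have vk: "van_kampen_diagram (gens k) (relators k) w D" using min by (simp add: minimal_diagram_def)
  have "(\<exists>j'\<le>Suc k. walk (fst (corr_step D \<tau> d)) (map (corr_step D \<tau>) (d # ds)) j') \<and>
    non_backtracking (map (corr_step D \<tau>) (d # ds)) \<and>
    (\<forall>e\<in>set (d # ds). snd (lab D e) = snd (lab D d))"
    using assms(4,5)
  proof (induction ds arbitrary: d)
    case Nil
    obtain i i' b where st: "corr_step D \<tau> d = (i, i', b)" by (metis prod_cases3)
    have "tau_triangle D \<tau> d" using Nil by simp
    from corridor_triangle[OF vk this c st HOL.refl] show ?case by (simp add: st)
  next
    case (Cons d' ds)
    have tri: "tau_triangle D \<tau> d" "tau_triangle D \<tau> d'" and next_d: "d' = opp D (exit_dart D \<tau> d)"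
      using Cons.prems by auto
    have IH: "(\<exists>j'\<le>Suc k. walk (fst (corr_step D \<tau> d')) (map (corr_step D \<tau>) (d' # ds)) j') \<and>
      non_backtracking (map (corr_step D \<tau>) (d' # ds)) \<and>
      (\<forall>e\<in>set (d' # ds). snd (lab D e) = snd (lab D d'))"
      using Cons by auto
    obtain i i' b where st: "corr_step D \<tau> d = (i, i', b)" by (metis prod_cases3)
    note t = corridor_triangle[OF vk tri(1) c st HOL.refl]
    have "exit_dart D \<tau> d \<in> darts D"
      using t(8) tri(1) van_kampen_perm(2)[OF vk] by (auto simp: tau_triangle_def inner_darts_def)
    then have l: "lab D d' = (c i', snd (lab D d))"
      using van_kampen_perm(3)[OF vk] t(2) by (simp add: next_d inv_letter_def)
    then have "fst (corr_step D \<tau> d') = i'" using c(1) by (auto simp: corr_step_def)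
    moreover have "\<not> backtrack (corr_step D \<tau> d) (corr_step D \<tau> d')"
      by (rule no_backtrack[OF min tri next_d c])
    ultimately show ?case using IH t(6) l by (simp add: st)
  qed
  then show "\<exists>j'\<le>Suc k. walk (fst (corr_step D \<tau> d)) (map (corr_step D \<tau>) (d # ds)) j'"
    "non_backtracking (map (corr_step D \<tau>) (d # ds))"
    "\<forall>e\<in>set (d # ds). snd (lab D e) = snd (lab D d)" by auto
qed

lemma corridor_sides:
  assumes min: "minimal_diagram (gens k) (relators k) w D"
    and C: "corridor D C" "fst C \<in> {alpha k, beta k}"
  defines "u \<equiv> map (lab D) (left_side D C)" and "v \<equiv> map (lab D) (right_side D C)"
  shows "linked k u v" "freely_reduced u" "freely_reduced v" "xword k u" "xword k v"
    "length (snd C) = length u + length v"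
proof -
  obtain \<tau> ds where Cd: "C = (\<tau>, ds)" by (cases C)
  obtain d ds' where ds: "ds = d # ds'" using C(1) by (cases ds) (auto simp: corridor_def Cd)
  obtain c where c: "c \<in> {A, B}" "\<tau> = c ` {1..k + 1}"
    using C(2) by (auto simp: alpha_def beta_def Cd)
  have vk: "van_kampen_diagram (gens k) (relators k) w D" using min by (simp add: minimal_diagram_def)
  have tri: "\<forall>d\<in>set ds. tau_triangle D \<tau> d" and succ: "successively (\<lambda>d e. e = opp D (exit_dart D \<tau> d)) ds"
    using C(1) by (auto simp: corridor_def Cd)
  note cw = corridor_walk[OF min c tri[unfolded ds] succ[unfolded ds], folded ds]
  define s where "s = snd (lab D d)"
  define ps where "ps = map (corr_step D \<tau>) ds"
  obtain i i' b where st: "corr_step D \<tau> d = (i, i', b)" by (metis prod_cases3)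
  have i: "i \<le> Suc k" using corridor_triangle(3)[OF vk _ c st HOL.refl] tri ds by simp
  obtain j' where wk: "j' \<le> Suc k" "walk i ps j'" using cw(1) by (auto simp: st ps_def)
  have nb: "non_backtracking ps" using cw(2) by (simp add: ps_def)
  have one: "snd (snd (corr_step D \<tau> e)) = (\<not> dart_in D \<tau> (nxt D e)) \<and>
    (dart_in D \<tau> (nxt D e) \<longrightarrow> lab D (opp D (nxt D (nxt D e))) = step_letter s (corr_step D \<tau> e)) \<and>
    (\<not> dart_in D \<tau> (nxt D e) \<longrightarrow> lab D (nxt D e) = step_letter s (corr_step D \<tau> e)) \<and>
    fst (step_letter s (corr_step D \<tau> e)) \<in> X ` {..k}"
    if e: "e \<in> set ds" for e
  proof -
    obtain i i' b where st: "corr_step D \<tau> e = (i, i', b)" by (metis prod_cases3)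
    have s: "s = snd (lab D e)" using cw(3) e by (simp add: s_def)
    have te: "tau_triangle D \<tau> e" using tri e by simp
    note t = corridor_triangle[OF vk te c st s]
    have "nxt D (nxt D e) \<in> darts D"
      using te van_kampen_perm(2)[OF vk] by (auto simp: tau_triangle_def inner_darts_def)
    then show ?thesis using t(5,7,9,10) van_kampen_perm(3)[OF vk] by (auto simp: st)
  qed
  have right: "(case corr_step D \<tau> e of (i, i', b') \<Rightarrow> b' = r) \<longleftrightarrow> dart_in D \<tau> (nxt D e) = (\<not> r)"
    if "e \<in> set ds" for e r
    using one[OF that] by (cases "corr_step D \<tau> e") auto
  have u: "u = side_word s False ps"
  proof -
    have filt: "filter (\<lambda>e. dart_in D \<tau> (nxt D e)) ds =
      filter ((\<lambda>(i, i', b'). b' = False) \<circ> corr_step D \<tau>) ds"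
      by (rule filter_cong[OF HOL.refl], simp only: comp_apply right, simp)
    have "u = map (\<lambda>e. step_letter s (corr_step D \<tau> e)) (filter (\<lambda>e. dart_in D \<tau> (nxt D e)) ds)"
      unfolding u_def left_side_def using one by (auto simp: Cd)
    also have "\<dots> = side_word s False ps"
      by (simp only: side_word_def ps_def filter_map filt[symmetric] map_map) (simp add: comp_def)
    finally show ?thesis .
  qed
  have v: "v = side_word s True ps"
  proof -
    have filt: "filter (\<lambda>e. \<not> dart_in D \<tau> (nxt D e)) ds =
      filter ((\<lambda>(i, i', b'). b' = True) \<circ> corr_step D \<tau>) ds"
      by (rule filter_cong[OF HOL.refl], simp only: comp_apply right, simp)
    have "v = map (\<lambda>e. step_letter s (corr_step D \<tau> e)) (filter (\<lambda>e. \<not> dart_in D \<tau> (nxt D e)) ds)"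
      unfolding v_def right_side_def using one by (auto simp: Cd)
    also have "\<dots> = side_word s True ps"
      by (simp only: side_word_def ps_def filter_map filt[symmetric] map_map) (simp add: comp_def)
    finally show ?thesis .
  qed
  show "linked k u v"
    using side_word_linked[OF wk(2), of s] i wk(1) unfolding u v linked_def by (cases s) auto
  show "freely_reduced u" "freely_reduced v"
    unfolding u v by (rule freely_reduced_side_word[OF wk(2) nb])+
  have "xword k (side_word s b ps)" for b
    using one unfolding xword_def side_word_def ps_def by (auto simp del: step_letter.simps)
  then show "xword k u" "xword k v" unfolding u v by blast+
  show "length (snd C) = length u + length v"
    using sum_length_filter_compl[of "\<lambda>d. dart_in D \<tau> (nxt D d)" ds]
    by (simp add: u_def v_def left_side_def right_side_def Cd)
qed

section \<open>Stacks\<close>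

lemma linked_family_length:
  assumes "\<And>i. i < h \<Longrightarrow> linked k (W i) (W (Suc i))"
    and "\<And>i. i \<le> h \<Longrightarrow> freely_reduced (W i) \<and> xword k (W i)" and "i \<le> h"
  shows "length (W i) \<le> (min (length (W 0)) (length (W h)) + 2 * Suc k * h) * (2 * k * h + 1)"
proof -
  have le: "(l + 2 * Suc k * m) * (2 * k * m + 1) \<le> (l + 2 * Suc k * h) * (2 * k * h + 1)"
    if "m \<le> h" for l m using that by (intro mult_le_mono add_le_mono) auto
  have "length (W i) \<le> (length (W 0) + 2 * Suc k * i) * (2 * k * i + 1)"
    by (rule linked_chain_length) (use assms in auto)
  moreover have "length (W i) \<le> (length (W h) + 2 * Suc k * (h - i)) * (2 * k * (h - i) + 1)"
  proof -
    have "linked k (W (h - n)) (W (h - Suc n))" if "n < h - i" for n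
      using linked_sym[OF assms(1)[of "h - Suc n"]] that by (simp add: Suc_diff_Suc)
    then show ?thesis using linked_chain_length[of k "\<lambda>n. W (h - n)" "h - i"] assms(2,3) by simp
  qed
  ultimately show ?thesis using le[OF assms(3)] le[of "h - i"] by (force simp: min_def intro: order_trans)
qed

lemma stack_area_le:
  assumes min: "minimal_diagram (gens k) (relators k) w D" and T: "stack k D T"
  defines "h \<equiv> length T" and "l \<equiv> length (stack_top D T)"
  shows "stack_area D T \<le> 2 * h * ((l + 2 * Suc k * h) * (2 * k * h + 1))"
proof -
  have ne: "T \<noteq> []" using T by (simp add: stack_def)
  define W where "W = (\<lambda>i. map (lab D)
    (case i of 0 \<Rightarrow> left_side D (hd T) | Suc j \<Rightarrow> right_side D (T ! j)))"
  have corr: "corridor D (T ! i)" "fst (T ! i) \<in> {alpha k, beta k}" if "i < h" for i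
    using T nth_mem[of i T] that unfolding stack_def h_def by blast+
  have Wl: "W i = map (lab D) (left_side D (T ! i))" if "i < h" for i
  proof (cases i)
    case 0
    then show ?thesis using ne by (simp add: W_def hd_conv_nth)
  next
    case (Suc j)
    have "right_path D (T ! j) = left_path D (T ! Suc j)"
      using T that unfolding stack_def h_def successively_conv_nth Suc by blast
    then show ?thesis by (simp add: W_def Suc right_path_def left_path_def)
  qed
  have Wr: "W (Suc i) = map (lab D) (right_side D (T ! i))" for i by (simp add: W_def)
  have h: "0 < h" using ne by (simp add: h_def)
  have good: "freely_reduced (W i) \<and> xword k (W i)" if "i \<le> h" for i
  proof (cases i)
    case 0
    then show ?thesis using corridor_sides[OF min corr[OF h]] Wl[OF h] by simp
  next
    case (Suc j)
    then have "j < h" using that by simp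
    then show ?thesis using corridor_sides[OF min corr[OF \<open>j < h\<close>]] Wr[of j] Suc by simp
  qed
  have link: "linked k (W i) (W (Suc i))" if "i < h" for i
    using corridor_sides(1)[OF min corr[OF that]] Wl[OF that] Wr[of i] by simp
  have "T ! (h - 1) = last T" using ne by (simp add: h_def last_conv_nth)
  then have "l = min (length (W 0)) (length (W h))"
    using h by (cases h) (auto simp: l_def stack_top_def W_def Let_def)
  then have bound: "length (W i) \<le> (l + 2 * Suc k * h) * (2 * k * h + 1)" (is "_ \<le> ?M") if "i \<le> h" for i
    using linked_family_length[where W = W and h = h, OF link good that] by simp
  have "stack_area D T \<le> (\<Sum>i<h. card (corr_cells D (T ! i)))"
  proof -
    have "(\<Union>C\<in>set T. corr_cells D C) = (\<Union>i<h. corr_cells D (T ! i))"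
      by (auto simp: set_conv_nth h_def)
    then show ?thesis unfolding stack_area_def by (simp add: card_UN_le)
  qed
  also have "\<dots> \<le> (\<Sum>i<h. 2 * ?M)"
  proof (rule sum_mono)
    fix i assume "i \<in> {..<h}"
    then have i: "i < h" by simp
    have "card (corr_cells D (T ! i)) \<le> length (snd (T ! i))"
      unfolding corr_cells_def by (metis card_image_le card_length finite_set order_trans)
    also have "\<dots> = length (W i) + length (W (Suc i))"
      using corridor_sides(6)[OF min corr[OF i]] Wl[OF i] Wr[of i] by simp
    also have "\<dots> \<le> 2 * ?M" using bound[of i] bound[of "Suc i"] i by simp
    finally show "card (corr_cells D (T ! i)) \<le> 2 * ?M" .
  qed
  also have "\<dots> = 2 * h * ?M" by (simp only: sum_constant card_lessThan of_nat_id mult_ac)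
  finally show ?thesis .
qed

theorem lemma4p10:
  fixes k :: nat
  assumes "k \<ge> 3"
  shows "\<exists>K::real. K > 0 \<and>
    (\<forall>(w :: gen word) (D :: gen diagram) (T :: gen corr list) (l :: nat) (h :: nat).
       w \<in> words (gens k) \<longrightarrow>
       freely_reduced w \<longrightarrow>
       eval_word k w = \<one>\<^bsub>H_susp k\<^esub> \<longrightarrow>
       minimal_diagram (gens k) (relators k) w D \<longrightarrow>
       stack k D T \<longrightarrow>
       length (stack_top D T) = l \<longrightarrow>
       stack_height T = h \<longrightarrow>
       real (stack_area D T) \<le> K * (real l * real h ^ 2 + real h ^ 3))"
proof (intro exI[of _ "real (4 * Suc k * (2 * k + 1))"] conjI allI impI)
  show "0 < real (4 * Suc k * (2 * k + 1))" by (simp only: of_nat_0_less_iff) simp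
  fix w D T l h
  assume min: "minimal_diagram (gens k) (relators k) w D" and T: "stack k D T"
    and l: "length (stack_top D T) = l" and h: "stack_height T = h"
  have "1 \<le> h" using T h by (cases T) (auto simp: stack_def stack_height_def)
  then have "2 * k * h + 1 \<le> (2 * k + 1) * h" by simp
  moreover have "l + 2 * Suc k * h \<le> 2 * Suc k * (l + h)" by (simp add: algebra_simps)
  ultimately have "(l + 2 * Suc k * h) * (2 * k * h + 1) \<le> (2 * Suc k * (l + h)) * ((2 * k + 1) * h)"
    by (rule mult_le_mono[rotated])
  then have "stack_area D T \<le> 2 * h * ((2 * Suc k * (l + h)) * ((2 * k + 1) * h))"
    using stack_area_le[OF min T] l h unfolding stack_height_def by (meson mult_le_mono2 order_trans)
  also have "\<dots> = 4 * Suc k * (2 * k + 1) * (l * h ^ 2 + h ^ 3)"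
    by (simp add: algebra_simps power2_eq_square power3_eq_cube)
  finally show "real (stack_area D T) \<le> real (4 * Suc k * (2 * k + 1)) * (real l * real h ^ 2 + real h ^ 3)"
    by (metis of_nat_add of_nat_le_iff of_nat_mult of_nat_power)
qed

end
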